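(* Let $\mathcal{P}$ be a non-trivial graph property. If $\mathcal{P}$ is (i) monotone, or (ii) ultimately clique-free, or (iii) weakly sparse, then the Harary polynomial $\chi_{\mathcal{P}}(G;x)$ is not $\mathrm{MSOL}_g$-definable.
   Context: All graphs are finite simple graphs; a graph property is a class of graphs closed under isomorphism. $\mathcal{P}$ is trivial if it is empty, finite up to isomorphism, or contains all finite graphs. $\mathcal{P}$ is monotone if closed under taking subgraphs. $\mathcal{P}$ is ultimately clique-free if there is $t\in\mathbb{N}$ such that no graph in $\mathcal{P}$ contains $K_t$; it is weakly sparse (ultimately biclique-free) if there is $t$ such that no graph in $\mathcal{P}$ contains the complete bipartite graph $K_{t,t}$ as a (not necessarily induced) subgraph. For a graph $G$, $b_i^{\mathcal{P}}(G)$ is the number of partitions of $V(G)$ into $i$ nonempty blocks each inducing a graph in $\mathcal{P}$, and the Harary polynomial is $\chi_{\mathcal{P}}(G;x)=\sum_i b_i^{\mathcal{P}}(G)\,x_{(i)}$ with $x_{(i)}=x(x-1)\cdots(x-i+1)$; for a positive integer $k$, $\chi_{\mathcal{P}}(G;k)$ counts maps $V(G)\to\{1,\dots,k\}$ whose nonempty color classes induce graphs in $\mathcal{P}$. $\mathrm{MSOL}_g$ is monadic second-order logic in the language of graphs (one binary edge relation; quantification over vertices and sets of vertices). A multivariate graph polynomial in indeterminates $x_1,\dots,x_m$ is $\mathrm{MSOL}_g$-definable in the sense of Courcelle–Makowsky–Rotics and Kotek–Makowsky: it is built inductively from expressions of the form $\sum_{U_1,\dots,U_s\subseteq V(G):\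 \phi(U_1,\dots,U_s)}\ \prod_{j}\prod_{v\in V(G):\ \psi_j(U_1,\dots,U_s,v)} x_j$ with $\phi,\psi_j$ $\mathrm{MSOL}_g$-formulas, using sums and products (a linear order on the vertices may also be used in the formulas, provided the resulting polynomial does not depend on the chosen order). A univariate graph polynomial is $\mathrm{MSOL}_g$-definable if it is a substitution instance (indeterminates replaced by polynomials in $x$) of a multivariate $\mathrm{MSOL}_g$-definable graph polynomial. *)

theory Defs
  imports
    "Graph_Theory.Graph_Theory"
    "HOL-Library.Disjoint_Sets"
    "HOL-Library.FuncSet"
    "HOL-Library.Poly_Mapping"
    "HOL-Computational_Algebra.Polynomial"
begin

section \<open>Graph properties\<close>

text \<open>
  A finite simple graph is a symmetric, loop-free pair digraph (locale \<^locale>\<open>pair_graph\<close>), each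
  edge being stored as two opposite arcs; the graph without vertices is included. Every finite graph
  has an isomorphic copy on a set of natural numbers, so classes of finite graphs are taken to be
  sets of graphs with vertices in \<^typ>\<open>nat\<close>.
\<close>

type_synonym ngraph = "nat pair_pre_digraph"

definition iso_graphs :: "ngraph \<Rightarrow> ngraph \<Rightarrow> bool" where
  "iso_graphs G H \<longleftrightarrow> digraph_iso (with_proj G) (with_proj H)"

definition graph_property :: "ngraph set \<Rightarrow> bool" where
  "graph_property P \<longleftrightarrow>
     (\<forall>G\<in>P. pair_graph G) \<and>
     (\<forall>G\<in>P. \<forall>H. pair_graph H \<and> iso_graphs G H \<longrightarrow> H \<in> P)"

definition finite_up_to_iso :: "ngraph set \<Rightarrow> bool" where
  "finite_up_to_iso P \<longleftrightarrow> (\<exists>F. finite F \<and> (\<forall>G\<in>P. \<exists>H\<in>F. iso_graphs G H))"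

definition trivial_property :: "ngraph set \<Rightarrow> bool" where
  "trivial_property P \<longleftrightarrow> P = {} \<or> finite_up_to_iso P \<or> (\<forall>G. pair_graph G \<longrightarrow> G \<in> P)"

definition monotone_property :: "ngraph set \<Rightarrow> bool" where
  "monotone_property P \<longleftrightarrow>
     (\<forall>G\<in>P. \<forall>H. pair_graph H \<and> subgraph (with_proj H) (with_proj G) \<longrightarrow> H \<in> P)"

definition ultimately_clique_free :: "ngraph set \<Rightarrow> bool" where
  "ultimately_clique_free P \<longleftrightarrow>
     (\<exists>t. \<forall>G\<in>P. \<not> (\<exists>H :: ngraph. subgraph (with_proj H) (with_proj G) \<and>
        complete_digraph t (with_proj H)))"

definition weakly_sparse :: "ngraph set \<Rightarrow> bool" where
  "weakly_sparse P \<longleftrightarrow>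
     (\<exists>t. \<forall>G\<in>P. \<not> (\<exists>H :: ngraph. subgraph (with_proj H) (with_proj G) \<and>
        complete_bipartite_digraph t t (with_proj H)))"

section \<open>The Harary polynomial\<close>

definition induced :: "ngraph \<Rightarrow> nat set \<Rightarrow> ngraph" where
  "induced G B = \<lparr> pverts = B, parcs = parcs G \<inter> B \<times> B \<rparr>"

definition num_partitions :: "ngraph set \<Rightarrow> ngraph \<Rightarrow> nat \<Rightarrow> nat" where
  "num_partitions P G i =
     card {\<pi>. partition_on (pverts G) \<pi> \<and> card \<pi> = i \<and> (\<forall>B\<in>\<pi>. induced G B \<in> P)}"

definition falling_poly :: "nat \<Rightarrow> 'a::comm_ring_1 poly" where
  "falling_poly i = (\<Prod>j<i. [:- of_nat j, 1:])"

definition harary_poly :: "ngraph set \<Rightarrow> ngraph \<Rightarrow> 'a::comm_ring_1 poly" where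
  "harary_poly P G = (\<Sum>i\<le>card (pverts G). of_nat (num_partitions P G i) * falling_poly i)"

section \<open>Monadic second-order logic of (ordered) graphs\<close>

text \<open>
  Vertex variables and set variables are two separate sorts, each indexed by natural numbers.
  \<open>Leq\<close> refers to the auxiliary linear order.
\<close>

datatype msol =
    Eq nat nat
  | Edge nat nat
  | Leq nat nat
  | Mem nat nat
  | Neg msol
  | Conj msol msol
  | ExV nat msol
  | ExS nat msol

fun free_v :: "msol \<Rightarrow> nat set" where
  "free_v (Eq x y) = {x, y}"
| "free_v (Edge x y) = {x, y}"
| "free_v (Leq x y) = {x, y}"
| "free_v (Mem x X) = {x}"
| "free_v (Neg \<phi>) = free_v \<phi>"
| "free_v (Conj \<phi> \<psi>) = free_v \<phi> \<union> free_v \<psi>"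
| "free_v (ExV x \<phi>) = free_v \<phi> - {x}"
| "free_v (ExS X \<phi>) = free_v \<phi>"

fun free_s :: "msol \<Rightarrow> nat set" where
  "free_s (Eq x y) = {}"
| "free_s (Edge x y) = {}"
| "free_s (Leq x y) = {}"
| "free_s (Mem x X) = {X}"
| "free_s (Neg \<phi>) = free_s \<phi>"
| "free_s (Conj \<phi> \<psi>) = free_s \<phi> \<union> free_s \<psi>"
| "free_s (ExV x \<phi>) = free_s \<phi>"
| "free_s (ExS X \<phi>) = free_s \<phi> - {X}"

fun sat :: "ngraph \<Rightarrow> nat rel \<Rightarrow> (nat \<Rightarrow> nat) \<Rightarrow> (nat \<Rightarrow> nat set) \<Rightarrow> msol \<Rightarrow> bool" where
  "sat G r a A (Eq x y) \<longleftrightarrow> a x = a y"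
| "sat G r a A (Edge x y) \<longleftrightarrow> (a x, a y) \<in> parcs G"
| "sat G r a A (Leq x y) \<longleftrightarrow> (a x, a y) \<in> r"
| "sat G r a A (Mem x X) \<longleftrightarrow> a x \<in> A X"
| "sat G r a A (Neg \<phi>) \<longleftrightarrow> \<not> sat G r a A \<phi>"
| "sat G r a A (Conj \<phi> \<psi>) \<longleftrightarrow> sat G r a A \<phi> \<and> sat G r a A \<psi>"
| "sat G r a A (ExV x \<phi>) \<longleftrightarrow> (\<exists>v\<in>pverts G. sat G r (a(x := v)) A \<phi>)"
| "sat G r a A (ExS X \<phi>) \<longleftrightarrow> (\<exists>U\<subseteq>pverts G. sat G r a (A(X := U)) \<phi>)"

section \<open>Definable graph polynomials\<close>

text \<open>
  Polynomials over the integers in indeterminates \<open>x\<^sub>0, x\<^sub>1, \<dots>\<close>: finitely supported maps from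
  exponent vectors to coefficients.
\<close>

type_synonym mpoly = "(nat \<Rightarrow>\<^sub>0 nat) \<Rightarrow>\<^sub>0 int"

definition indet :: "nat \<Rightarrow> mpoly" where
  "indet j = Poly_Mapping.single (Poly_Mapping.single j 1) 1"

definition subst_poly :: "(nat \<Rightarrow> 'a::comm_ring_1 poly) \<Rightarrow> mpoly \<Rightarrow> 'a poly" where
  "subst_poly \<sigma> p = (\<Sum>m\<in>Poly_Mapping.keys p. of_int (Poly_Mapping.lookup p m) *
     (\<Prod>j\<in>Poly_Mapping.keys m. \<sigma> j ^ Poly_Mapping.lookup m j))"

text \<open>
  The basic expressions: the sum over all \<open>U\<^sub>0, \<dots>, U\<^bsub>s-1\<^esub>\<close> satisfying \<open>\<phi>\<close> of the product of the
  \<open>x\<^sub>j\<close> over all \<open>j\<close> and all vertices \<open>v\<close> satisfying \<open>\<psi>\<^sub>j\<close>. Set variable \<open>i < s\<close> stands for \<open>U\<^sub>i\<close>, and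
  vertex variable 0 of \<open>\<psi>\<^sub>j\<close> stands for \<open>v\<close>; the condition \<open>basic_wf\<close> on the free variables makes the
  values of all other variables irrelevant.
\<close>

definition basic_wf :: "nat \<Rightarrow> msol \<Rightarrow> msol list \<Rightarrow> bool" where
  "basic_wf s \<phi> \<psi>s \<longleftrightarrow> free_v \<phi> = {} \<and> free_s \<phi> \<subseteq> {..<s} \<and>
     (\<forall>\<psi>\<in>set \<psi>s. free_v \<psi> \<subseteq> {0} \<and> free_s \<psi> \<subseteq> {..<s})"

definition basic_poly :: "nat \<Rightarrow> msol \<Rightarrow> msol list \<Rightarrow> ngraph \<Rightarrow> nat rel \<Rightarrow> mpoly" where
  "basic_poly s \<phi> \<psi>s G r =
     (\<Sum>U \<in> {U \<in> {..<s} \<rightarrow>\<^sub>E Pow (pverts G). sat G r (\<lambda>_. undefined) U \<phi>}.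
        \<Prod>j<length \<psi>s. \<Prod>v \<in> {v \<in> pverts G. sat G r (\<lambda>_. v) U (\<psi>s ! j)}. indet j)"

inductive msol_expr :: "(ngraph \<Rightarrow> nat rel \<Rightarrow> mpoly) \<Rightarrow> bool" where
  basic: "basic_wf s \<phi> \<psi>s \<Longrightarrow> msol_expr (basic_poly s \<phi> \<psi>s)"
| add: "msol_expr p \<Longrightarrow> msol_expr q \<Longrightarrow> msol_expr (\<lambda>G r. p G r + q G r)"
| mult: "msol_expr p \<Longrightarrow> msol_expr q \<Longrightarrow> msol_expr (\<lambda>G r. p G r * q G r)"

text \<open>
  Since \<open>f G\<close> does not mention the order \<open>r\<close>, this includes independence of the chosen order.
\<close>

definition msol_definable_multi :: "(ngraph \<Rightarrow> mpoly) \<Rightarrow> bool" where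
  "msol_definable_multi f \<longleftrightarrow>
     (\<exists>p. msol_expr p \<and>
        (\<forall>G r. pair_graph G \<and> linear_order_on (pverts G) r \<longrightarrow> f G = p G r))"

definition msol_definable :: "(ngraph \<Rightarrow> 'a::comm_ring_1 poly) \<Rightarrow> bool" where
  "msol_definable p \<longleftrightarrow>
     (\<exists>f \<sigma>. msol_definable_multi f \<and> (\<forall>G. pair_graph G \<longrightarrow> p G = subst_poly \<sigma> (f G)))"

end

theory Submission
  imports Defs
begin

text \<open>
  A monotone property that misses a graph on \<open>n\<close> vertices contains no graph with a \<open>K\<^sub>n\<close>, and
  \<open>K\<^bsub>2t\<^esub>\<close> contains \<open>K\<^bsub>t,t\<^esub>\<close>; hence in all three cases \<open>P\<close> is ultimately clique-free.

  By a Feferman-Vaught argument for joins of graphs (with the ordered sum of the linear orders), a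
  definable polynomial takes on joins the form
  \<open>p (G \<bowtie> G') = (\<Sum>c<R. \<alpha> c G * \<beta> c G')\<close> with \<open>R\<close> depending only on \<open>p\<close>. So the matrix of its
  values on joins has rank at most \<open>R\<close>, also after evaluation at any integer \<open>k\<close>.

  Take a nonempty \<open>H\<close> in \<open>P\<close> and let \<open>H\<^sub>n\<close> be the join of \<open>n\<close> copies of \<open>H\<close>. The value of the Harary
  polynomial of \<open>H\<^sub>n\<close> at \<open>k\<close> is nonzero for \<open>n = k\<close>, as each copy may be one block, and zero for
  \<open>n > k t\<close>, as some block then contains a \<open>K\<^sub>t\<close>. If \<open>M \<ge> k\<close> is the largest \<open>n\<close> with nonzero value,
  the matrix of the values on \<open>H\<^sub>i \<bowtie> H\<^sub>j = H\<^bsub>i+j\<^esub>\<close>, where \<open>i, j \<le> M\<close>, is zero below the antidiagonal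
  and nonzero on it, so it has rank \<open>M + 1 > k\<close>. For \<open>k = R\<close> this is a contradiction.
\<close>

section \<open>Isomorphic copies and colourings\<close>

text \<open>Of the values of the Harary polynomial only their zero pattern matters: over a ring of
  characteristic zero the value at \<open>k\<close> is nonzero exactly for these graphs
  (\<open>poly_harary_poly_eq_0_iff\<close>).\<close>

definition colourable :: "ngraph set \<Rightarrow> nat \<Rightarrow> ngraph \<Rightarrow> bool" where
  "colourable P k G \<longleftrightarrow>
     (\<exists>\<pi>. partition_on (pverts G) \<pi> \<and> card \<pi> \<le> k \<and> (\<forall>B\<in>\<pi>. induced G B \<in> P))"

lemma pair_graph_iff:
  "pair_graph G \<longleftrightarrow> finite (pverts G) \<and> parcs G \<subseteq> pverts G \<times> pverts G \<and> sym (parcs G) \<and>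
     (\<forall>v. (v, v) \<notin> parcs G)" (is "_ \<longleftrightarrow> ?R")
proof
  assume "pair_graph G"
  then interpret pair_graph G .
  show ?R
    using pair_finite_verts in_arcsD1 in_arcsD2 pair_sym_arcs pair_no_loops[of "(v, v)" for v]
    by (auto simp: symmetric_def)
next
  assume R: ?R
  then have "finite (parcs G)" by (meson finite_SigmaI finite_subset)
  with R show "pair_graph G"
    by unfold_locales (auto simp: symmetric_def)
qed

lemma subgraph_pair_iff:
  assumes "pair_graph G" "pair_graph H"
  shows "subgraph (with_proj H) (with_proj G) \<longleftrightarrow> pverts H \<subseteq> pverts G \<and> parcs H \<subseteq> parcs G"
proof -
  interpret G: pair_graph G by fact
  interpret H: pair_graph H by fact
  show ?thesis
    by (auto simp: subgraph_def compatible_def G.wf_digraph H.wf_digraph)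
qed

definition image_graph :: "(nat \<Rightarrow> nat) \<Rightarrow> ngraph \<Rightarrow> ngraph" where
  "image_graph f G = \<lparr> pverts = f ` pverts G, parcs = map_prod f f ` parcs G \<rparr>"

lemma pair_graph_image:
  assumes "pair_graph G" "inj_on f (pverts G)"
  shows "pair_graph (image_graph f G)"
proof -
  have G: "finite (pverts G)" "parcs G \<subseteq> pverts G \<times> pverts G" "sym (parcs G)" "\<And>v. (v, v) \<notin> parcs G"
    using assms(1) pair_graph_iff by blast+
  have "sym (map_prod f f ` parcs G)"
  proof (rule symI, clarsimp)
    fix u v assume "(u, v) \<in> parcs G"
    then have "(v, u) \<in> parcs G" using G(3) by (rule symD[rotated])
    then show "(f v, f u) \<in> map_prod f f ` parcs G" by force
  qed
  moreover have "f u \<noteq> f v" if "(u, v) \<in> parcs G" for u v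
    using that G(2,4) assms(2) by (metis inj_onD mem_Sigma_iff subsetD)
  ultimately show ?thesis
    using G(1,2) by (auto simp: pair_graph_iff image_graph_def)
qed

lemma iso_graphs_image:
  assumes "pair_graph G" "inj_on f (pverts G)"
  shows "iso_graphs G (image_graph f G)"
proof -
  interpret pair_graph G by fact
  have "parcs G \<subseteq> pverts G \<times> pverts G" using assms pair_graph_iff by blast
  then have "inj_on (map_prod f f) (parcs G)"
    using map_prod_inj_on[OF assms(2) assms(2)] inj_on_subset by blast
  then have "digraph_isomorphism
      \<lparr> iso_verts = f, iso_arcs = map_prod f f, iso_head = snd, iso_tail = fst \<rparr>"
    using assms(2) wf_digraph by (simp add: digraph_isomorphism_def)
  then show ?thesis
    unfolding iso_graphs_def digraph_iso_def
    by (intro exI conjI) (auto simp: app_iso_def image_graph_def with_proj_def)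
qed

lemma graph_property_image:
  assumes "graph_property P" "G \<in> P" "inj_on f (pverts G)"
  shows "image_graph f G \<in> P"
  using assms iso_graphs_image pair_graph_image unfolding graph_property_def by blast

lemma image_graph_inverse:
  assumes "pair_graph G" "inj_on f (pverts G)"
  shows "image_graph (the_inv_into (pverts G) f) (image_graph f G) = G"
proof -
  have sub: "parcs G \<subseteq> pverts G \<times> pverts G" using assms pair_graph_iff by blast
  have inv: "the_inv_into (pverts G) f (f v) = v" if "v \<in> pverts G" for v
    using assms that by (simp add: the_inv_into_f_f)
  have "(\<lambda>v. the_inv_into (pverts G) f (f v)) ` pverts G = pverts G"
    using inv by force
  moreover have "map_prod (the_inv_into (pverts G) f) (the_inv_into (pverts G) f) (map_prod f f e) = e"
    if "e \<in> parcs G" for e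
    using sub that inv by (cases e) auto
  then have "(\<lambda>e. map_prod (the_inv_into (pverts G) f) (the_inv_into (pverts G) f)
      (map_prod f f e)) ` parcs G = parcs G"
    by force
  ultimately show ?thesis
    by (simp add: image_graph_def image_image)
qed

lemma graph_property_image_iff:
  assumes "graph_property P" "pair_graph G" "inj_on f (pverts G)"
  shows "image_graph f G \<in> P \<longleftrightarrow> G \<in> P"
proof
  assume "image_graph f G \<in> P"
  then have "image_graph (the_inv_into (pverts G) f) (image_graph f G) \<in> P"
    by (rule graph_property_image[OF assms(1)])
      (simp add: image_graph_def inj_on_the_inv_into assms(3))
  then show "G \<in> P" by (simp add: image_graph_inverse assms)
qed (use assms graph_property_image in blast)

lemma colourable_image:
  assumes "graph_property P" "pair_graph G" "inj_on f (pverts G)" "colourable P k G"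
  shows "colourable P k (image_graph f G)"
proof -
  obtain \<pi> where \<pi>: "partition_on (pverts G) \<pi>" "card \<pi> \<le> k" "\<forall>B\<in>\<pi>. induced G B \<in> P"
    using assms(4) colourable_def by auto
  have fin: "finite (pverts G)" and sub: "parcs G \<subseteq> pverts G \<times> pverts G"
    using assms(2) pair_graph_iff by blast+
  have "card ((`) f ` \<pi>) \<le> k"
    using \<pi> finite_elements[OF fin \<pi>(1)] card_image_le le_trans by blast
  moreover have "induced (image_graph f G) (f ` B) \<in> P" if "B \<in> \<pi>" for B
  proof -
    have B: "B \<subseteq> pverts G" using \<pi>(1) that partition_onD1 by auto
    \<comment> \<open>Injectivity on all vertices, not only on \<open>B\<close>, keeps vertices
      outside \<open>B\<close> out of the image of \<open>B\<close>. Hence the image of a block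
      induces an isomorphic copy of what the block induces.\<close>
    have B_iff: "f u \<in> f ` B \<longleftrightarrow> u \<in> B" if "u \<in> pverts G" for u
      using inj_on_image_mem_iff[OF assms(3) that B] .
    have arc_iff: "map_prod f f e \<in> f ` B \<times> f ` B \<longleftrightarrow> e \<in> B \<times> B" if "e \<in> parcs G" for e
    proof (cases e)
      case (Pair u v)
      then have "u \<in> pverts G" "v \<in> pverts G" using sub that by auto
      then show ?thesis by (simp only: Pair map_prod_simp mem_Sigma_iff B_iff)
    qed
    have image_Int: "h ` A \<inter> C = h ` {e \<in> A. h e \<in> C}" for h :: "nat \<times> nat \<Rightarrow> nat \<times> nat" and A C
      by blast
    have "map_prod f f ` parcs G \<inter> f ` B \<times> f ` B =
        map_prod f f ` {e \<in> parcs G. map_prod f f e \<in> f ` B \<times> f ` B}"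
      by (rule image_Int)
    also have "{e \<in> parcs G. map_prod f f e \<in> f ` B \<times> f ` B} = parcs G \<inter> B \<times> B"
      using arc_iff by (intro set_eqI) (simp only: mem_Collect_eq Int_iff cong: conj_cong)
    finally have "map_prod f f ` parcs G \<inter> f ` B \<times> f ` B = map_prod f f ` (parcs G \<inter> B \<times> B)" .
    then have "induced (image_graph f G) (f ` B) = image_graph f (induced G B)"
      by (simp add: induced_def image_graph_def)
    moreover have "inj_on f (pverts (induced G B))"
      using assms(3) B by (simp add: induced_def inj_on_subset)
    ultimately show ?thesis
      using graph_property_image[OF assms(1)] \<pi>(3) that by simp
  qed
  moreover have "(`) f ` \<pi> - {{}} = (`) f ` \<pi>" using partition_onD3[OF \<pi>(1)] by auto
  then have "partition_on (f ` pverts G) ((`) f ` \<pi>)"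
    using partition_on_inj_image[OF \<pi>(1) assms(3)] by simp
  ultimately show ?thesis
    unfolding colourable_def by (intro exI[of _ "(`) f ` \<pi>"]) (auto simp: image_graph_def)
qed

section \<open>Reduction of all three cases to ultimate clique-freeness\<close>

lemma ultimately_clique_free_weakly_sparse:
  assumes "graph_property P" "weakly_sparse P"
  shows "ultimately_clique_free P"
proof -
  obtain t where t: "\<And>G H. G \<in> P \<Longrightarrow> subgraph (with_proj (H :: ngraph)) (with_proj G) \<Longrightarrow>
      \<not> complete_bipartite_digraph t t (with_proj H)"
    using assms(2) unfolding weakly_sparse_def by blast
  have "\<not> complete_digraph (t + t) (with_proj H)"
    if G: "G \<in> P" and H: "subgraph (with_proj (H :: ngraph)) (with_proj G)" for G H
  proof
    assume K: "complete_digraph (t + t) (with_proj H)"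
    then have fin: "finite (pverts H)" and card: "card (pverts H) = t + t"
      and arcs: "parcs H = {(u, v). (u, v) \<in> pverts H \<times> pverts H \<and> u \<noteq> v}"
      by (simp_all add: complete_digraph_pair_def)
    obtain A where A: "A \<subseteq> pverts H" "card A = t" "finite A"
      using obtain_subset_with_card_n[of t "pverts H"] card by auto
    define B where "B = pverts H - A"
    have B: "card B = t" "finite B" using A card fin by (simp_all add: B_def card_Diff_subset)
    \<comment> \<open>Keeping only the arcs between two halves of a clique on \<open>t + t\<close>
      vertices leaves a biclique.\<close>
    define K' :: ngraph where "K' = \<lparr> pverts = pverts H, parcs = A \<times> B \<union> B \<times> A \<rparr>"
    have "complete_bipartite_digraph t t (with_proj K')"
      unfolding complete_bipartite_digraph_pair_def using A B fin
      by (intro conjI exI[of _ A] exI[of _ B]) (auto simp: K'_def B_def)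
    moreover have "pair_graph G" using G assms(1) by (simp add: graph_property_def)
    moreover have "pair_graph K'" using fin A by (auto simp: pair_graph_iff K'_def B_def sym_def)
    moreover have "pair_graph H" using pair_graphI_complete[OF K] .
    moreover have "parcs K' \<subseteq> parcs H" "pverts K' \<subseteq> pverts H"
      using A arcs by (auto simp: K'_def B_def)
    ultimately show False using t[OF G, of K'] H by (auto simp: subgraph_pair_iff)
  qed
  then show ?thesis unfolding ultimately_clique_free_def by blast
qed

text \<open>Any bijection from the vertices of \<open>F\<close> to those of a clique of the same
  size carries arcs to arcs, since distinct vertices of the clique are adjacent. By monotonicity a
  graph in \<open>P\<close> with such a clique would put a copy of \<open>F\<close> into
  \<open>P\<close>.\<close>

lemma ultimately_clique_free_monotone:
  assumes "graph_property P" "monotone_property P" "pair_graph F" "F \<notin> P"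
  shows "ultimately_clique_free P"
proof -
  have "\<not> complete_digraph (card (pverts F)) (with_proj H)"
    if G: "G \<in> P" and H: "subgraph (with_proj (H :: ngraph)) (with_proj G)" for G H
  proof
    assume K: "complete_digraph (card (pverts F)) (with_proj H)"
    then have fin: "finite (pverts H)" and card: "card (pverts F) = card (pverts H)"
      and arcs: "parcs H = {(u, v). (u, v) \<in> pverts H \<times> pverts H \<and> u \<noteq> v}"
      by (simp_all add: complete_digraph_pair_def)
    have F: "finite (pverts F)" "parcs F \<subseteq> pverts F \<times> pverts F" "\<And>v. (v, v) \<notin> parcs F"
      using assms(3) pair_graph_iff by blast+
    obtain f where f: "bij_betw f (pverts F) (pverts H)"
      using finite_same_card_bij[OF F(1) fin card] by blast
    then have inj: "inj_on f (pverts F)" and img: "f ` pverts F = pverts H"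
      by (simp_all add: bij_betw_def)
    have "parcs (image_graph f F) \<subseteq> parcs H"
    proof (clarsimp simp: image_graph_def)
      fix u v assume uv: "(u, v) \<in> parcs F"
      then have "u \<in> pverts F" "v \<in> pverts F" "u \<noteq> v" using F by auto
      then show "(f u, f v) \<in> parcs H" using inj img arcs by (auto dest: inj_onD)
    qed
    then have "subgraph (with_proj (image_graph f F)) (with_proj H)"
      using pair_graphI_complete[OF K] pair_graph_image[OF assms(3) inj] img
      by (simp add: subgraph_pair_iff image_graph_def)
    then have "image_graph f F \<in> P"
      using assms(2) G H pair_graph_image[OF assms(3) inj] pair_graphI_complete[OF K]
      unfolding monotone_property_def by blast
    then show False using assms inj graph_property_image_iff by blast
  qed
  then show ?thesis unfolding ultimately_clique_free_def by blast
qed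

section \<open>Joins of copies of a graph\<close>

text \<open>The join of copies of \<open>H\<close> indexed by \<open>S\<close>; vertex \<open>v\<close> of copy \<open>m\<close> is
  \<^term>\<open>prod_encode (m, v)\<close>.\<close>

definition blowup :: "ngraph \<Rightarrow> nat set \<Rightarrow> ngraph" where
  "blowup H S = \<lparr> pverts = prod_encode ` (S \<times> pverts H),
     parcs = {(prod_encode (m, u), prod_encode (m', v)) | m m' u v.
        m \<in> S \<and> m' \<in> S \<and> u \<in> pverts H \<and> v \<in> pverts H \<and> (m = m' \<longrightarrow> (u, v) \<in> parcs H)} \<rparr>"

lemma pair_graph_blowup:
  assumes "pair_graph H" "finite S"
  shows "pair_graph (blowup H S)"
proof -
  have H: "finite (pverts H)" "sym (parcs H)" "\<And>v. (v, v) \<notin> parcs H"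
    using assms(1) pair_graph_iff by blast+
  have "sym (parcs (blowup H S))"
    using H(2) by (intro symI) (auto simp: blowup_def prod_encode_eq dest: symD)
  then show ?thesis
    using H(1,3) assms(2) by (auto simp: pair_graph_iff blowup_def prod_encode_eq)
qed

lemma blowup_image:
  assumes "inj_on g S"
  shows "blowup H (g ` S) =
    image_graph (\<lambda>x. case prod_decode x of (m, v) \<Rightarrow> prod_encode (g m, v)) (blowup H S)"
    (is "_ = image_graph ?f _")
proof -
  have "parcs (blowup H (g ` S)) = map_prod ?f ?f ` parcs (blowup H S)"
  proof (intro equalityI subsetI)
    fix e assume "e \<in> parcs (blowup H (g ` S))"
    then obtain m m' u v where e: "e = (prod_encode (g m, u), prod_encode (g m', v))"
      "m \<in> S" "m' \<in> S" "u \<in> pverts H" "v \<in> pverts H" "g m = g m' \<longrightarrow> (u, v) \<in> parcs H"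
      by (auto simp: blowup_def)
    then show "e \<in> map_prod ?f ?f ` parcs (blowup H S)"
      by (intro image_eqI[of _ _ "(prod_encode (m, u), prod_encode (m', v))"])
        (auto simp: blowup_def)
  next
    fix e assume "e \<in> map_prod ?f ?f ` parcs (blowup H S)"
    then obtain m m' u v where e: "e = (prod_encode (g m, u), prod_encode (g m', v))"
      "m \<in> S" "m' \<in> S" "u \<in> pverts H" "v \<in> pverts H" "m = m' \<longrightarrow> (u, v) \<in> parcs H"
      by (auto simp: blowup_def)
    \<comment> \<open>Injectivity keeps different copies different, so arcs between two copies never
      become subject to the condition for arcs within one copy.\<close>
    moreover have "g m = g m' \<longrightarrow> m = m'" using assms e by (auto dest: inj_onD)
    ultimately show "e \<in> parcs (blowup H (g ` S))" by (auto simp: blowup_def)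
  qed
  moreover have "pverts (blowup H (g ` S)) = ?f ` pverts (blowup H S)"
    by (force simp: blowup_def image_image)
  ultimately show ?thesis by (simp add: image_graph_def)
qed

lemma colourable_blowup_image:
  assumes "graph_property P" "pair_graph H" "finite S" "inj_on g S" "colourable P k (blowup H S)"
  shows "colourable P k (blowup H (g ` S))"
  unfolding blowup_image[OF assms(4)]
proof (rule colourable_image[OF assms(1) pair_graph_blowup[OF assms(2,3)] _ assms(5)])
  show "inj_on (\<lambda>x. case prod_decode x of (m, v) \<Rightarrow> prod_encode (g m, v)) (pverts (blowup H S))"
    using assms(4) by (auto simp: blowup_def inj_on_def prod_encode_eq)
qed

text \<open>Lets rows and columns of the matrix use disjoint index sets while its entries depend
  only on the number of copies.\<close>

lemma colourable_blowup_card: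
  assumes "graph_property P" "pair_graph H" "finite S"
  shows "colourable P k (blowup H S) \<longleftrightarrow> colourable P k (blowup H {..<card S})"
proof -
  obtain g where "bij_betw g S {..<card S}"
    using finite_same_card_bij[of S "{..<card S}"] assms(3) by auto
  moreover obtain h where "bij_betw h {..<card S} S"
    using finite_same_card_bij[of "{..<card S}" S] assms(3) by auto
  ultimately show ?thesis
    using colourable_blowup_image[OF assms(1,2)] assms(3) unfolding bij_betw_def
    by (metis finite_lessThan)
qed

lemma colourable_blowup_small:
  assumes "graph_property P" "H \<in> P" "pverts H \<noteq> {}" "finite S" "card S \<le> k"
  shows "colourable P k (blowup H S)"
proof -
  define B where "B m = prod_encode ` ({m} \<times> pverts H)" for m
  have H: "parcs H \<subseteq> pverts H \<times> pverts H"
    using assms(1,2) by (auto simp: graph_property_def pair_graph_iff)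
  \<comment> \<open>The copies of \<open>H\<close> are the blocks; they are nonempty because
    \<open>H\<close> has a vertex.\<close>
  have "partition_on (pverts (blowup H S)) (B ` S)"
    using assms(3) by (intro partition_onI) (auto simp: B_def blowup_def prod_encode_eq disjnt_def)
  moreover have "card (B ` S) \<le> k" using assms card_image_le le_trans by blast
  moreover have "induced (blowup H S) (B m) \<in> P" if "m \<in> S" for m
  proof -
    have "induced (blowup H S) (B m) = image_graph (\<lambda>v. prod_encode (m, v)) H"
      using that H by (auto simp: induced_def blowup_def B_def image_graph_def prod_encode_eq)
    then show ?thesis
      using graph_property_image[OF assms(1,2), of "\<lambda>v. prod_encode (m, v)"]
      by (simp add: inj_on_def prod_encode_eq)
  qed
  ultimately show ?thesis unfolding colourable_def by (intro exI[of _ "B ` S"]) simp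
qed

text \<open>Fix one vertex \<open>v\<close> of \<open>H\<close>. Its images in the copies are
  pairwise adjacent, so more than \<open>t\<close> of them in one block would give a clique of size
  \<open>t\<close> inside a graph of \<open>P\<close>. Adding up over at most \<open>k\<close>
  blocks bounds the number of copies.\<close>

lemma colourable_blowup_bound:
  assumes "graph_property P" "pair_graph H" "pverts H \<noteq> {}" "finite S"
    and free: "\<And>G H. G \<in> P \<Longrightarrow> subgraph (with_proj (H :: ngraph)) (with_proj G) \<Longrightarrow>
      \<not> complete_digraph t (with_proj H)"
    and "colourable P k (blowup H S)"
  shows "card S \<le> k * t"
proof -
  obtain \<pi> where \<pi>: "partition_on (pverts (blowup H S)) \<pi>" "card \<pi> \<le> k"
      "\<And>B. B \<in> \<pi> \<Longrightarrow> induced (blowup H S) B \<in> P"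
    using assms(6) unfolding colourable_def by blast
  obtain v where v: "v \<in> pverts H" using assms(3) by blast
  have "finite (pverts (blowup H S))"
    using pair_graph_blowup[OF assms(2,4)] pair_graph_iff by blast
  then have fin: "finite \<pi>" using \<pi>(1) finite_elements by blast
  define Q where "Q B = {m \<in> S. prod_encode (m, v) \<in> B}" for B
  have "card (Q B) \<le> t" if B: "B \<in> \<pi>" for B
  proof (rule ccontr)
    assume "\<not> card (Q B) \<le> t"
    then obtain T where T: "T \<subseteq> Q B" "card T = t" "finite T"
      using obtain_subset_with_card_n[of t "Q B"] by auto
    define V where "V = (\<lambda>m. prod_encode (m, v)) ` T"
    define K :: ngraph where "K = \<lparr> pverts = V, parcs = {(x, y). (x, y) \<in> V \<times> V \<and> x \<noteq> y} \<rparr>"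
    have "card V = t" using T(2) by (simp add: V_def card_image inj_on_def prod_encode_eq)
    then have K: "complete_digraph t (with_proj K)"
      using T(3) by (simp add: complete_digraph_pair_def K_def V_def)
    have "pair_graph (induced (blowup H S) B)"
      using \<pi>(3)[OF B] assms(1) by (simp add: graph_property_def)
    moreover have "parcs K \<subseteq> parcs (induced (blowup H S) B)"
    proof
      fix e assume "e \<in> parcs K"
      then obtain m m' where "e = (prod_encode (m, v), prod_encode (m', v))" "m \<in> T" "m' \<in> T" "m \<noteq> m'"
        by (auto simp: K_def V_def)
      then show "e \<in> parcs (induced (blowup H S) B)"
        using v T(1) by (auto simp: Q_def induced_def blowup_def)
    qed
    moreover have "pverts K \<subseteq> pverts (induced (blowup H S) B)"
      using T(1) by (auto simp: K_def V_def Q_def induced_def)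
    ultimately show False
      using free[OF \<pi>(3)[OF B], of K] K pair_graphI_complete[OF K] by (simp add: subgraph_pair_iff)
  qed
  then have "(\<Sum>B\<in>\<pi>. card (Q B)) \<le> card \<pi> * t" using sum_bounded_above[of \<pi> "\<lambda>B. card (Q B)" t] by simp
  moreover have "S = (\<Union>B\<in>\<pi>. Q B)"
    using partition_onD1[OF \<pi>(1)] v by (auto simp: Q_def blowup_def)
  then have "card S \<le> (\<Sum>B\<in>\<pi>. card (Q B))" using card_UN_le[OF fin, of Q] by simp
  ultimately show ?thesis using \<pi>(2) by (meson le_trans mult_le_mono1)
qed

text \<open>If every member had no vertices, \<open>P\<close> would have at most one isomorphism
  class and so be finite up to isomorphism.\<close>

lemma nontrivial_nonempty:
  assumes "graph_property P" "\<not> trivial_property P"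
  obtains H where "H \<in> P" "pverts H \<noteq> {}"
proof (rule ccontr)
  assume "\<not> thesis"
  then have empty: "pverts G = {}" if "G \<in> P" for G
    using that \<open>\<And>H. H \<in> P \<Longrightarrow> pverts H \<noteq> {} \<Longrightarrow> thesis\<close> by blast
  define E :: ngraph where "E = \<lparr> pverts = {}, parcs = {} \<rparr>"
  have "iso_graphs G E" if "G \<in> P" for G
  proof -
    have "pair_graph G" using that assms(1) by (simp add: graph_property_def)
    moreover have "image_graph id G = E"
      using empty[OF that] \<open>pair_graph G\<close> by (auto simp: image_graph_def E_def pair_graph_iff)
    ultimately show ?thesis using iso_graphs_image[of G id] by simp
  qed
  then have "finite_up_to_iso P"
    unfolding finite_up_to_iso_def by (intro exI[of _ "{E}"]) simp
  then show False using assms(2) by (simp add: trivial_property_def)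
qed

section \<open>Composition of formulas over joins\<close>

definition join :: "ngraph \<Rightarrow> ngraph \<Rightarrow> ngraph" where
  "join G G' = \<lparr> pverts = pverts G \<union> pverts G',
     parcs = parcs G \<union> parcs G' \<union> pverts G \<times> pverts G' \<union> pverts G' \<times> pverts G \<rparr>"

text \<open>All of \<open>G\<close> precedes all of \<open>G'\<close>, so comparing vertices of
  different factors needs no information about either order.\<close>

definition order_sum :: "ngraph \<Rightarrow> nat rel \<Rightarrow> ngraph \<Rightarrow> nat rel \<Rightarrow> nat rel" where
  "order_sum G r G' r' = r \<union> r' \<union> pverts G \<times> pverts G'"

definition ordered_graph :: "ngraph \<Rightarrow> nat rel \<Rightarrow> bool" where
  "ordered_graph G r \<longleftrightarrow> pair_graph G \<and> linear_order_on (pverts G) r"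

definition disjoint_ordered :: "ngraph \<Rightarrow> nat rel \<Rightarrow> ngraph \<Rightarrow> nat rel \<Rightarrow> bool" where
  "disjoint_ordered G r G' r' \<longleftrightarrow>
     ordered_graph G r \<and> ordered_graph G' r' \<and> pverts G \<inter> pverts G' = {}"

lemma pverts_join [simp]: "pverts (join G G') = pverts G \<union> pverts G'"
  by (simp add: join_def)

type_synonym side_pred =
  "ngraph \<Rightarrow> nat rel \<Rightarrow> (nat \<Rightarrow> nat) \<Rightarrow> (nat \<Rightarrow> nat set) \<Rightarrow> bool"

text \<open>Vertex variables in \<open>W\<close> are interpreted in the left factor of the join, all others in the
  right one.\<close>

definition splits :: "msol \<Rightarrow> nat set \<Rightarrow> 'i set \<Rightarrow> ('i \<Rightarrow> side_pred) \<Rightarrow> ('i \<Rightarrow> side_pred) \<Rightarrow> bool" where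
  "splits \<phi> W I L R \<longleftrightarrow>
     (\<forall>G r G' r' a a' A A'. disjoint_ordered G r G' r' \<longrightarrow>
        (\<forall>x\<in>free_v \<phi>. if x \<in> W then a x \<in> pverts G else a' x \<in> pverts G') \<longrightarrow>
        (\<forall>X\<in>free_s \<phi>. A X \<subseteq> pverts G \<and> A' X \<subseteq> pverts G') \<longrightarrow>
        (sat (join G G') (order_sum G r G' r') (\<lambda>x. if x \<in> W then a x else a' x)
             (\<lambda>X. A X \<union> A' X) \<phi> \<longleftrightarrow>
         (\<exists>i\<in>I. L i G r a A \<and> R i G' r' a' A')))"

lemma splitsD:
  assumes "splits \<phi> W I L R" "disjoint_ordered G r G' r'"
    "\<And>x. x \<in> free_v \<phi> \<Longrightarrow> if x \<in> W then a x \<in> pverts G else a' x \<in> pverts G'"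
    "\<And>X. X \<in> free_s \<phi> \<Longrightarrow> A X \<subseteq> pverts G \<and> A' X \<subseteq> pverts G'"
  shows "sat (join G G') (order_sum G r G' r') (\<lambda>x. if x \<in> W then a x else a' x)
             (\<lambda>X. A X \<union> A' X) \<phi> \<longleftrightarrow> (\<exists>i\<in>I. L i G r a A \<and> R i G' r' a' A')"
  using assms unfolding splits_def by simp

text \<open>The induction on formulas produces powersets, products and disjoint sums as index sets.
  Renumbering them keeps one index type throughout.\<close>

lemma splits_reindex:
  assumes "finite I" "splits \<phi> W I L R"
  shows "\<exists>(N::nat) L R. splits \<phi> W {..<N} L R"
proof -
  obtain h where h: "bij_betw h {..<card I} I"
    using ex_bij_betw_nat_finite[OF assms(1)] by (auto simp: atLeast0LessThan)
  then have img: "h ` {..<card I} = I" by (simp add: bij_betw_def)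
  have "(\<exists>i\<in>h ` {..<card I}. Q i) \<longleftrightarrow> (\<exists>i\<in>{..<card I}. Q (h i))" for Q by simp
  then have "(\<exists>i\<in>I. Q i) \<longleftrightarrow> (\<exists>i\<in>{..<card I}. Q (h i))" for Q unfolding img .
  with assms(2) have "splits \<phi> W {..<card I} (\<lambda>i. L (h i)) (\<lambda>i. R (h i))"
    unfolding splits_def by simp
  then show ?thesis by blast
qed

text \<open>A single conjunct with a constantly true right half is enough when the left factor alone
  decides the formula; this includes formulas whose truth value is constant.\<close>

lemma splits_left:
  assumes "\<And>G r G' r' a a' A A'. disjoint_ordered G r G' r' \<Longrightarrow>
        (\<forall>x\<in>free_v \<phi>. if x \<in> W then a x \<in> pverts G else a' x \<in> pverts G') \<Longrightarrow>
        (\<forall>X\<in>free_s \<phi>. A X \<subseteq> pverts G \<and> A' X \<subseteq> pverts G') \<Longrightarrow>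
        sat (join G G') (order_sum G r G' r') (\<lambda>x. if x \<in> W then a x else a' x)
             (\<lambda>X. A X \<union> A' X) \<phi> \<longleftrightarrow> L G r a A"
  shows "\<exists>(N::nat) L R. splits \<phi> W {..<N} L R"
proof (rule splits_reindex[of "{()}"])
  show "splits \<phi> W {()} (\<lambda>_. L) (\<lambda>_ _ _ _ _. True)"
    unfolding splits_def using assms by simp
qed simp

lemma splits_right:
  assumes "\<And>G r G' r' a a' A A'. disjoint_ordered G r G' r' \<Longrightarrow>
        (\<forall>x\<in>free_v \<phi>. if x \<in> W then a x \<in> pverts G else a' x \<in> pverts G') \<Longrightarrow>
        (\<forall>X\<in>free_s \<phi>. A X \<subseteq> pverts G \<and> A' X \<subseteq> pverts G') \<Longrightarrow>
        sat (join G G') (order_sum G r G' r') (\<lambda>x. if x \<in> W then a x else a' x)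
             (\<lambda>X. A X \<union> A' X) \<phi> \<longleftrightarrow> R G' r' a' A'"
  shows "\<exists>(N::nat) L R. splits \<phi> W {..<N} L R"
proof (rule splits_reindex[of "{()}"])
  show "splits \<phi> W {()} (\<lambda>_ _ _ _ _. True) (\<lambda>_. R)"
    unfolding splits_def using assms by simp
qed simp

lemma disjoint_orderedD:
  assumes "disjoint_ordered G r G' r'"
  shows "parcs G \<subseteq> pverts G \<times> pverts G" "parcs G' \<subseteq> pverts G' \<times> pverts G'"
    "r \<subseteq> pverts G \<times> pverts G" "r' \<subseteq> pverts G' \<times> pverts G'" "pverts G \<inter> pverts G' = {}"
    "finite (pverts G)" "finite (pverts G')"
  using assms
  by (auto simp: disjoint_ordered_def ordered_graph_def pair_graph_iff order_on_defs)

text \<open>Induction on the formula, for all \<open>W\<close> at once because a quantified vertex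
  may lie on either side. Atoms with both variables on one side are decided there. Across the
  factors, equality fails by disjointness, adjacency holds by the definition of the join, and the
  order holds exactly from left to right.\<close>

lemma splits_exists: "\<exists>(N::nat) L R. splits \<phi> W {..<N} L R"
proof (induction \<phi> arbitrary: W)
  case (Eq x y)
  consider "x \<in> W" "y \<in> W" | "x \<notin> W" "y \<notin> W" | "(x \<in> W) \<noteq> (y \<in> W)" by blast
  then show ?case
  proof cases
    case 1
    then show ?thesis by (intro splits_left[where L = "\<lambda>G r a A. a x = a y"]) simp
  next
    case 2
    then show ?thesis by (intro splits_right[where R = "\<lambda>G r a A. a x = a y"]) simp
  next
    case 3
    then show ?thesis
      by (intro splits_left[where L = "\<lambda>G r a A. False"])
        (use disjoint_orderedD(5) in \<open>fastforce split: if_splits\<close>)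
  qed
next
  case (Edge x y)
  consider "x \<in> W" "y \<in> W" | "x \<notin> W" "y \<notin> W" | "(x \<in> W) \<noteq> (y \<in> W)" by blast
  then show ?case
  proof cases
    case 1
    show ?thesis
    proof (rule splits_left[where L = "\<lambda>G r a A. (a x, a y) \<in> parcs G"], goal_cases)
      case (1 G r G' r' a a' A A')
      then show ?case using disjoint_orderedD[OF 1(1)] \<open>x \<in> W\<close> \<open>y \<in> W\<close>
        by (auto simp: join_def)
    qed
  next
    case 2
    show ?thesis
    proof (rule splits_right[where R = "\<lambda>G r a A. (a x, a y) \<in> parcs G"], goal_cases)
      case (1 G r G' r' a a' A A')
      then show ?case using disjoint_orderedD[OF 1(1)] \<open>x \<notin> W\<close> \<open>y \<notin> W\<close>
        by (auto simp: join_def)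
    qed
  next
    case 3
    then show ?thesis
      by (intro splits_left[where L = "\<lambda>G r a A. True"]) (auto simp: join_def split: if_splits)
  qed
next
  case (Leq x y)
  consider "x \<in> W" "y \<in> W" | "x \<notin> W" "y \<notin> W" | "x \<in> W" "y \<notin> W" | "x \<notin> W" "y \<in> W" by blast
  then show ?case
  proof cases
    case 1
    show ?thesis
    proof (rule splits_left[where L = "\<lambda>G r a A. (a x, a y) \<in> r"], goal_cases)
      case (1 G r G' r' a a' A A')
      then show ?case using disjoint_orderedD[OF 1(1)] \<open>x \<in> W\<close> \<open>y \<in> W\<close>
        by (auto simp: order_sum_def)
    qed
  next
    case 2
    show ?thesis
    proof (rule splits_right[where R = "\<lambda>G r a A. (a x, a y) \<in> r"], goal_cases)
      case (1 G r G' r' a a' A A')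
      then show ?case using disjoint_orderedD[OF 1(1)] \<open>x \<notin> W\<close> \<open>y \<notin> W\<close>
        by (auto simp: order_sum_def)
    qed
  next
    case 3
    then show ?thesis
      by (intro splits_left[where L = "\<lambda>G r a A. True"]) (auto simp: order_sum_def)
  next
    case 4
    show ?thesis
    proof (rule splits_left[where L = "\<lambda>G r a A. False"], goal_cases)
      case (1 G r G' r' a a' A A')
      then show ?case using disjoint_orderedD[OF 1(1)] \<open>x \<notin> W\<close> \<open>y \<in> W\<close>
        by (auto simp: order_sum_def)
    qed
  qed
next
  case (Mem x X)
  show ?case
  proof (cases "x \<in> W")
    case True
    show ?thesis
    proof (rule splits_left[where L = "\<lambda>G r a A. a x \<in> A X"], goal_cases)
      case (1 G r G' r' a a' A A')
      then show ?case using disjoint_orderedD(5)[OF 1(1)] True by auto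
    qed
  next
    case False
    show ?thesis
    proof (rule splits_right[where R = "\<lambda>G r a A. a x \<in> A X"], goal_cases)
      case (1 G r G' r' a a' A A')
      then show ?case using disjoint_orderedD(5)[OF 1(1)] False by auto
    qed
  qed
next
  case (Neg \<phi>)
  obtain N :: nat and L R where 1: "splits \<phi> W {..<N} L R" using Neg by blast
  \<comment> \<open>Choose for each index a side on which the conjunct fails.\<close>
  have *: "(\<not> (\<exists>i\<in>{..<N}. p i \<and> q i)) \<longleftrightarrow>
      (\<exists>S\<in>Pow {..<N}. (\<forall>i\<in>S. \<not> p i) \<and> (\<forall>i\<in>{..<N} - S. \<not> q i))" for p q :: "nat \<Rightarrow> bool"
  proof
    assume "\<not> (\<exists>i\<in>{..<N}. p i \<and> q i)"
    then show "\<exists>S\<in>Pow {..<N}. (\<forall>i\<in>S. \<not> p i) \<and> (\<forall>i\<in>{..<N} - S. \<not> q i)"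
      by (intro bexI[of _ "{i\<in>{..<N}. \<not> p i}"]) auto
  qed blast
  show ?case
  proof (rule splits_reindex)
    show "finite (Pow {..<N})" by simp
    show "splits (Neg \<phi>) W (Pow {..<N}) (\<lambda>S G r a A. \<forall>i\<in>S. \<not> L i G r a A)
        (\<lambda>S G r a A. \<forall>i\<in>{..<N} - S. \<not> R i G r a A)"
      using 1 unfolding splits_def *[symmetric] by simp
  qed
next
  case (Conj \<phi> \<psi>)
  obtain N :: nat and L R where 1: "splits \<phi> W {..<N} L R" using Conj by blast
  obtain N' :: nat and L' R' where 2: "splits \<psi> W {..<N'} L' R'" using Conj by blast
  show ?case
  proof (rule splits_reindex)
    show "finite ({..<N} \<times> {..<N'})" by simp
    have "(\<exists>ij\<in>{..<N} \<times> {..<N'}. (p (fst ij) \<and> p' (snd ij)) \<and> (q (fst ij) \<and> q' (snd ij))) \<longleftrightarrow>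
       (\<exists>i\<in>{..<N}. p i \<and> q i) \<and> (\<exists>i\<in>{..<N'}. p' i \<and> q' i)" for p p' q q' :: "nat \<Rightarrow> bool"
      by fastforce
    then show "splits (Conj \<phi> \<psi>) W ({..<N} \<times> {..<N'})
        (\<lambda>ij G r a A. L (fst ij) G r a A \<and> L' (snd ij) G r a A)
        (\<lambda>ij G r a A. R (fst ij) G r a A \<and> R' (snd ij) G r a A)"
      using 1 2 unfolding splits_def by simp
  qed
next
  case (ExV x \<phi>)
  \<comment> \<open>A witness for \<open>x\<close> lies in one of the two factors. Each possibility
    has its own decomposition, and the quantifier moves into the half that contains the witness; the
    disjoint sum collects both families of disjuncts.\<close>
  obtain N :: nat and L R where 1: "splits \<phi> (insert x W) {..<N} L R" using ExV by blast
  obtain N' :: nat and L' R' where 2: "splits \<phi> (W - {x}) {..<N'} L' R'" using ExV by blast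
  show ?case
  proof (rule splits_reindex)
    show "finite ({..<N} <+> {..<N'})" by simp
    show "splits (ExV x \<phi>) W ({..<N} <+> {..<N'})
        (case_sum (\<lambda>i G r a A. \<exists>v\<in>pverts G. L i G r (a(x := v)) A) L')
        (case_sum R (\<lambda>i G r a A. \<exists>v\<in>pverts G. R' i G r (a(x := v)) A))"
      unfolding splits_def
    proof (intro allI impI, goal_cases)
      case (1 G r G' r' a a' A A')
      let ?sat = "\<lambda>b. sat (join G G') (order_sum G r G' r') b (\<lambda>X. A X \<union> A' X) \<phi>"
      let ?b = "\<lambda>y. if y \<in> W then a y else a' y"
      have left: "?sat (?b(x := v)) \<longleftrightarrow> (\<exists>i<N. L i G r (a(x := v)) A \<and> R i G' r' a' A')"
        if "v \<in> pverts G" for v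
      proof -
        have "?b(x := v) = (\<lambda>y. if y \<in> insert x W then (a(x := v)) y else a' y)" by auto
        then show ?thesis
          using splitsD[OF \<open>splits \<phi> (insert x W) {..<N} L R\<close> 1(1), of "a(x := v)" a' A A'] 1 that
          by (auto split: if_splits)
      qed
      have right: "?sat (?b(x := v)) \<longleftrightarrow> (\<exists>i<N'. L' i G r a A \<and> R' i G' r' (a'(x := v)) A')"
        if "v \<in> pverts G'" for v
      proof -
        have "?b(x := v) = (\<lambda>y. if y \<in> W - {x} then a y else (a'(x := v)) y)" by auto
        then show ?thesis
          using splitsD[OF \<open>splits \<phi> (W - {x}) {..<N'} L' R'\<close> 1(1), of a "a'(x := v)" A A'] 1 that
          by (auto split: if_splits)
      qed
      have "sat (join G G') (order_sum G r G' r') ?b (\<lambda>X. A X \<union> A' X) (ExV x \<phi>) \<longleftrightarrow>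
          (\<exists>v\<in>pverts G. ?sat (?b(x := v))) \<or> (\<exists>v\<in>pverts G'. ?sat (?b(x := v)))"
        by auto
      also have "\<dots> \<longleftrightarrow> (\<exists>v\<in>pverts G. \<exists>i<N. L i G r (a(x := v)) A \<and> R i G' r' a' A') \<or>
          (\<exists>v\<in>pverts G'. \<exists>i<N'. L' i G r a A \<and> R' i G' r' (a'(x := v)) A')"
        using left right by auto
      finally have "sat (join G G') (order_sum G r G' r') ?b (\<lambda>X. A X \<union> A' X) (ExV x \<phi>) \<longleftrightarrow>
          \<dots>" .
      moreover have "(\<exists>i\<in>{..<N} <+> {..<N'}. Q i) \<longleftrightarrow> (\<exists>i<N. Q (Inl i)) \<or> (\<exists>i<N'. Q (Inr i))" for Q
        by (auto simp: Plus_def)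
      ultimately show ?case by (simp only: sum.case) blast
    qed
  qed
next
  case (ExS X \<phi>)
  \<comment> \<open>A vertex set of the join is a union of independently chosen parts in the two
    factors, so the set quantifier distributes over each conjunct and the number of disjuncts stays
    the same.\<close>
  obtain N :: nat and L R where 1: "splits \<phi> W {..<N} L R" using ExS by blast
  show ?case
  proof (rule splits_reindex)
    show "finite {..<N}" by simp
    show "splits (ExS X \<phi>) W {..<N}
        (\<lambda>i G r a A. \<exists>U\<subseteq>pverts G. L i G r a (A(X := U)))
        (\<lambda>i G r a A. \<exists>U\<subseteq>pverts G. R i G r a (A(X := U)))"
      unfolding splits_def
    proof (intro allI impI, goal_cases)
      case (1 G r G' r' a a' A A')
      let ?sat = "\<lambda>B. sat (join G G') (order_sum G r G' r') (\<lambda>y. if y \<in> W then a y else a' y) B \<phi>"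
      let ?B = "\<lambda>Y. A Y \<union> A' Y"
      have split: "?sat (?B(X := U \<union> U')) \<longleftrightarrow>
          (\<exists>i<N. L i G r a (A(X := U)) \<and> R i G' r' a' (A'(X := U')))"
        if "U \<subseteq> pverts G" "U' \<subseteq> pverts G'" for U U'
      proof -
        have "?B(X := U \<union> U') = (\<lambda>Y. (A(X := U)) Y \<union> (A'(X := U')) Y)" by (rule ext) simp
        then show ?thesis
          using splitsD[OF \<open>splits \<phi> W {..<N} L R\<close> 1(1), of a a' "A(X := U)" "A'(X := U')"] 1 that
          by auto
      qed
      have "sat (join G G') (order_sum G r G' r') (\<lambda>y. if y \<in> W then a y else a' y) ?B (ExS X \<phi>) \<longleftrightarrow>
          (\<exists>U\<subseteq>pverts G \<union> pverts G'. ?sat (?B(X := U)))" by simp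
      also have "\<dots> \<longleftrightarrow> (\<exists>U\<subseteq>pverts G. \<exists>U'\<subseteq>pverts G'. ?sat (?B(X := U \<union> U')))"
      proof (intro iffI; elim exE conjE)
        fix U assume U: "U \<subseteq> pverts G \<union> pverts G'" "?sat (?B(X := U))"
        then have "U \<inter> pverts G \<union> U \<inter> pverts G' = U" by blast
        then show "\<exists>U\<subseteq>pverts G. \<exists>U'\<subseteq>pverts G'. ?sat (?B(X := U \<union> U'))"
          using U(2) by (intro exI[of _ "U \<inter> pverts G"] conjI exI[of _ "U \<inter> pverts G'"]) simp_all
      next
        fix U U' assume "U \<subseteq> pverts G" "U' \<subseteq> pverts G'" "?sat (?B(X := U \<union> U'))"
        then show "\<exists>U\<subseteq>pverts G \<union> pverts G'. ?sat (?B(X := U))"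
          by (intro exI[of _ "U \<union> U'"] conjI Un_mono)
      qed
      also have "\<dots> \<longleftrightarrow> (\<exists>U\<subseteq>pverts G. \<exists>U'\<subseteq>pverts G'.
          \<exists>i<N. L i G r a (A(X := U)) \<and> R i G' r' a' (A'(X := U')))"
        using split by (simp cong: conj_cong)
      finally show ?case by auto
    qed
  qed
qed

section \<open>Finite rank on joins\<close>

text \<open>The rank of the matrix with ordered graphs as rows and columns is bounded through a
  factorisation, which makes sense over any commutative ring, in particular for values in
  \<open>mpoly\<close>.\<close>

definition finite_join_rank :: "(ngraph \<Rightarrow> nat rel \<Rightarrow> 'b::comm_ring_1) \<Rightarrow> bool" where
  "finite_join_rank p \<longleftrightarrow>
     (\<exists>(R::nat) \<alpha> \<beta>. \<forall>G r G' r'. disjoint_ordered G r G' r' \<longrightarrow>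
        p (join G G') (order_sum G r G' r') = (\<Sum>c<R. \<alpha> c G r * \<beta> c G' r'))"

lemma finite_join_rankI:
  assumes "finite I"
    and eq: "\<And>G r G' r'. disjoint_ordered G r G' r' \<Longrightarrow>
       p (join G G') (order_sum G r G' r') = (\<Sum>c\<in>I. \<alpha> c G r * \<beta> c G' r')"
  shows "finite_join_rank p"
proof -
  obtain h where h: "bij_betw h {..<card I} I"
    using ex_bij_betw_nat_finite[OF assms(1)] by (auto simp: atLeast0LessThan)
  then have "p (join G G') (order_sum G r G' r') = (\<Sum>c<card I. \<alpha> (h c) G r * \<beta> (h c) G' r')"
    if "disjoint_ordered G r G' r'" for G r G' r'
    using eq[OF that] sum.reindex_bij_betw[OF h, of "\<lambda>c. \<alpha> c G r * \<beta> c G' r'"] by simp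
  then show ?thesis
    unfolding finite_join_rank_def
    by (intro exI[of _ "card I"] exI[of _ "\<lambda>c. \<alpha> (h c)"] exI[of _ "\<lambda>c. \<beta> (h c)"]) blast
qed

lemma finite_join_rankE:
  assumes "finite_join_rank p"
  obtains R :: nat and \<alpha> \<beta> where "\<And>G r G' r'. disjoint_ordered G r G' r' \<Longrightarrow>
    p (join G G') (order_sum G r G' r') = (\<Sum>c<R. \<alpha> c G r * \<beta> c G' r')"
  using assms unfolding finite_join_rank_def by (elim exE) simp

lemma finite_join_rank_add:
  assumes "finite_join_rank p" "finite_join_rank q"
  shows "finite_join_rank (\<lambda>G r. p G r + q G r)"
proof (rule finite_join_rankE[OF assms(1)], rule finite_join_rankE[OF assms(2)], goal_cases)
  case (1 R \<alpha> \<beta> R' \<alpha>' \<beta>')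
  show ?case
    by (rule finite_join_rankI[of "{..<R} <+> {..<R'}" _ "case_sum \<alpha> \<alpha>'" "case_sum \<beta> \<beta>'"])
      (simp_all add: 1 sum.Plus)
qed

text \<open>As for entrywise products of matrices, the bounds multiply: pairs of indices index the
  new factorisation.\<close>

lemma finite_join_rank_mult:
  assumes "finite_join_rank p" "finite_join_rank q"
  shows "finite_join_rank (\<lambda>G r. p G r * q G r)"
proof (rule finite_join_rankE[OF assms(1)], rule finite_join_rankE[OF assms(2)], goal_cases)
  case (1 R \<alpha> \<beta> R' \<alpha>' \<beta>')
  show ?case
  proof (rule finite_join_rankI)
    show "finite ({..<R} \<times> {..<R'})" by simp
    fix G r G' r' assume "disjoint_ordered G r G' r'"
    then have "p (join G G') (order_sum G r G' r') * q (join G G') (order_sum G r G' r') =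
        (\<Sum>c\<in>{..<R} \<times> {..<R'}. (\<alpha> (fst c) G r * \<beta> (fst c) G' r') * (\<alpha>' (snd c) G r * \<beta>' (snd c) G' r'))"
      by (simp add: 1 sum_product sum.cartesian_product split_def)
    then show "p (join G G') (order_sum G r G' r') * q (join G G') (order_sum G r G' r') =
        (\<Sum>c\<in>{..<R} \<times> {..<R'}. (\<alpha> (fst c) G r * \<alpha>' (snd c) G r) * (\<beta> (fst c) G' r' * \<beta>' (snd c) G' r'))"
      by (simp add: mult_ac)
  qed
qed

section \<open>Basic expressions have finite rank on joins\<close>

lemma bij_betw_PiE_Pow_Un:
  assumes "V \<inter> V' = {}"
  shows "bij_betw (\<lambda>(U, U') X. U X \<union> U' X)
    ((I \<rightarrow>\<^sub>E Pow V) \<times> (I \<rightarrow>\<^sub>E Pow V')) (I \<rightarrow>\<^sub>E Pow (V \<union> V'))"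
\<comment> \<open>The inverse cuts every set down to the two factors. Outside \<open>I\<close> all
  functions are \<open>undefined\<close>, and the union of \<open>undefined\<close> with itself is
  again \<open>undefined\<close>, so extensionality survives.\<close>
proof (rule bij_betw_byWitness[where
      f' = "\<lambda>U. (restrict (\<lambda>X. U X \<inter> V) I, restrict (\<lambda>X. U X \<inter> V') I)"], goal_cases)
  case 1
  have "restrict (\<lambda>X. (U X \<union> U' X) \<inter> V) I = U \<and> restrict (\<lambda>X. (U X \<union> U' X) \<inter> V') I = U'"
    if "U \<in> I \<rightarrow>\<^sub>E Pow V" "U' \<in> I \<rightarrow>\<^sub>E Pow V'" for U U'
  proof (intro conjI ext)
    fix X
    have "U X \<subseteq> V" "U' X \<subseteq> V'" if "X \<in> I"
      using PiE_mem[OF \<open>U \<in> _\<close> that] PiE_mem[OF \<open>U' \<in> _\<close> that] by simp_all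
    then show "restrict (\<lambda>X. (U X \<union> U' X) \<inter> V) I X = U X" "restrict (\<lambda>X. (U X \<union> U' X) \<inter> V') I X = U' X"
      using PiE_arb[OF that(1)] PiE_arb[OF that(2)] assms by (cases "X \<in> I"; force)+
  qed
  then show ?case by auto
next
  case 2
  show ?case
  proof (intro ballI ext, goal_cases)
    case (1 U X)
    then show ?case by (cases "X \<in> I") (auto dest: PiE_mem PiE_arb)
  qed
next
  case 3
  show ?case by (auto simp: PiE_def extensional_def Pi_def)
next
  case 4
  show ?case by auto
qed

lemma splits_exists_choice:
  "\<exists>(N :: nat \<Rightarrow> nat) L R. \<forall>j. splits (\<phi> j) W {..<N j} (L j) (R j)"
proof -
  have "\<forall>j. \<exists>(N::nat) L R. splits (\<phi> j) W {..<N} L R" using splits_exists by blast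
  from choice[OF this] obtain N :: "nat \<Rightarrow> nat"
    where "\<forall>j. \<exists>L R. splits (\<phi> j) W {..<N j} L R" ..
  from choice[OF this] obtain L where "\<forall>j. \<exists>R. splits (\<phi> j) W {..<N j} (L j) R" ..
  from choice[OF this] show ?thesis by blast
qed

text \<open>Call \<open>t\<close> and \<open>t'\<close> the types of the two parts of a tuple of
  sets. The pair of types decides whether \<open>\<phi>\<close> holds on the join, and for a fixed
  pair the weight is a left factor times a right factor. The number of types is bounded by the
  formulas alone, so grouping the tuples by pairs of types yields the factorisation.\<close>

lemma finite_join_rank_basic:
  assumes wf: "basic_wf s \<phi> \<psi>s"
  shows "finite_join_rank (basic_poly s \<phi> \<psi>s)"
proof -
  define n where "n = length \<psi>s"
  \<comment> \<open>This is the assignment under which \<open>basic_poly\<close> evaluates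
    \<open>\<phi>\<close>; it also serves as the assignment on the side that does not contain the
    vertex of a weight formula.\<close>
  define un where "un = (\<lambda>_::nat. undefined :: nat)"
  obtain N :: nat and L R where sp: "splits \<phi> UNIV {..<N} L R"
    using splits_exists by blast
  \<comment> \<open>The vertex of a weight formula may lie in either factor: the decompositions for
    \<open>UNIV\<close> place it on the left, those for \<open>{}\<close> on the right. Types are
    tagged by 0 for \<open>\<phi>\<close> and by \<open>Suc j\<close> for the \<open>j\<close>-th
    weight formula.\<close>
  obtain N1 :: "nat \<Rightarrow> nat" and L1 R1 where sp1: "\<And>j. splits (\<psi>s ! j) UNIV {..<N1 j} (L1 j) (R1 j)"
    using splits_exists_choice[of "(!) \<psi>s"] by blast
  obtain N2 :: "nat \<Rightarrow> nat" and L2 R2 where sp2: "\<And>j. splits (\<psi>s ! j) {} {..<N2 j} (L2 j) (R2 j)"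
    using splits_exists_choice[of "(!) \<psi>s"] by blast
  \<comment> \<open>\<open>t\<close> records which left conjuncts hold for the left parts of the sets. This is all the right
    factor has to know about the left one, and conversely for \<open>t'\<close>.\<close>
  define Z where "Z = Pair 0 ` {..<N} \<union> (\<Union>j<n. Pair (Suc j) ` {..<N2 j})"
  define Z' where "Z' = Pair 0 ` {..<N} \<union> (\<Union>j<n. Pair (Suc j) ` {..<N1 j})"
  define t where "t G r U = Pair 0 ` {i. i < N \<and> L i G r un U} \<union>
      (\<Union>j<n. Pair (Suc j) ` {i. i < N2 j \<and> L2 j i G r un U})" for G r U
  define t' where "t' G r U = Pair 0 ` {i. i < N \<and> R i G r un U} \<union>
      (\<Union>j<n. Pair (Suc j) ` {i. i < N1 j \<and> R1 j i G r un U})" for G r U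
  define ok where "ok T T' \<longleftrightarrow> (\<exists>i<N. (0, i) \<in> T \<and> (0, i) \<in> T')" for T T' :: "(nat \<times> nat) set"
  \<comment> \<open>The halves belonging to the other factor are looked up in its type, so
    \<open>F\<close> sees the right factor only through \<open>T'\<close>, and \<open>F'\<close>
    sees the left one only through \<open>T\<close>.\<close>
  define F where "F T' G r U = (\<Prod>j<n. \<Prod>v\<in>{v \<in> pverts G.
      \<exists>i<N1 j. L1 j i G r (\<lambda>_. v) U \<and> (Suc j, i) \<in> T'}. indet j)" for T' G r U
  define F' where "F' T G r U = (\<Prod>j<n. \<Prod>v\<in>{v \<in> pverts G.
      \<exists>i<N2 j. (Suc j, i) \<in> T \<and> R2 j i G r (\<lambda>_. v) U}. indet j)" for T G r U
  \<comment> \<open>The compatibility test depends on the types alone and is put into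
    \<open>\<alpha>\<close>, so that it enters the product once.\<close>
  define \<alpha> where "\<alpha> = (\<lambda>(T, T') G r. if ok T T'
      then \<Sum>U\<in>{U \<in> {..<s} \<rightarrow>\<^sub>E Pow (pverts G). t G r U = T}. F T' G r U else 0)"
  define \<beta> where "\<beta> = (\<lambda>(T, T') G r.
      \<Sum>U\<in>{U \<in> {..<s} \<rightarrow>\<^sub>E Pow (pverts G). t' G r U = T'}. F' T G r U)"
  show ?thesis
  proof (rule finite_join_rankI[of "Pow Z \<times> Pow Z'" _ \<alpha> \<beta>])
    show "finite (Pow Z \<times> Pow Z')" by (simp add: Z_def Z'_def)
  next
    fix G r G' r'
    assume dis: "disjoint_ordered G r G' r'"
    note d = disjoint_orderedD[OF dis]
    define E where "E = ({..<s} \<rightarrow>\<^sub>E Pow (pverts G))"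
    define E' where "E' = ({..<s} \<rightarrow>\<^sub>E Pow (pverts G'))"
    let ?J = "join G G'" and ?o = "order_sum G r G' r'"
    have fin: "finite E" "finite E'" using d unfolding E_def E'_def by (auto intro: finite_PiE)
    have sub: "U X \<subseteq> pverts G \<and> U' X \<subseteq> pverts G'" if "U \<in> E" "U' \<in> E'" "X < s" for U U' X
      using that PiE_mem[of U "{..<s}" "\<lambda>_. Pow (pverts G)" X]
        PiE_mem[of U' "{..<s}" "\<lambda>_. Pow (pverts G')" X]
      unfolding E_def E'_def by simp
    have in_t: "(0, i) \<in> t G r U \<longleftrightarrow> i < N \<and> L i G r un U"
      "(Suc j, i) \<in> t G r U \<longleftrightarrow> j < n \<and> i < N2 j \<and> L2 j i G r un U" for i j U
      unfolding t_def by (auto simp: image_iff)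
    have in_t': "(0, i) \<in> t' G' r' U \<longleftrightarrow> i < N \<and> R i G' r' un U"
      "(Suc j, i) \<in> t' G' r' U \<longleftrightarrow> j < n \<and> i < N1 j \<and> R1 j i G' r' un U" for i j U
      unfolding t'_def by (auto simp: image_iff)
    have sat_\<phi>: "sat ?J ?o un (\<lambda>X. U X \<union> U' X) \<phi> \<longleftrightarrow> ok (t G r U) (t' G' r' U')"
      if "U \<in> E" "U' \<in> E'" for U U'
      using splitsD[OF sp dis, of un un U U'] wf sub[OF that]
      by (auto simp: basic_wf_def ok_def in_t in_t')
    have sat_left: "sat ?J ?o (\<lambda>_. v) (\<lambda>X. U X \<union> U' X) (\<psi>s ! j) \<longleftrightarrow>
        (\<exists>i<N1 j. L1 j i G r (\<lambda>_. v) U \<and> (Suc j, i) \<in> t' G' r' U')"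
      if "U \<in> E" "U' \<in> E'" "j < n" "v \<in> pverts G" for U U' j v
    proof -
      have "\<psi>s ! j \<in> set \<psi>s" using that n_def by simp
      then have "U X \<subseteq> pverts G \<and> U' X \<subseteq> pverts G'" if "X \<in> free_s (\<psi>s ! j)" for X
        using wf that sub[OF \<open>U \<in> E\<close> \<open>U' \<in> E'\<close>] unfolding basic_wf_def by blast
      then have "sat ?J ?o (\<lambda>_. v) (\<lambda>X. U X \<union> U' X) (\<psi>s ! j) \<longleftrightarrow> (\<exists>i\<in>{..<N1 j}. L1 j i G r (\<lambda>_. v) U \<and> R1 j i G' r' un U')"
        using splitsD[OF sp1 dis, of j "\<lambda>_. v" un U U'] that(4) by simp
      then show ?thesis using that(3) by (auto simp: in_t')
    qed
    have sat_right: "sat ?J ?o (\<lambda>_. v) (\<lambda>X. U X \<union> U' X) (\<psi>s ! j) \<longleftrightarrow>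
        (\<exists>i<N2 j. (Suc j, i) \<in> t G r U \<and> R2 j i G' r' (\<lambda>_. v) U')"
      if "U \<in> E" "U' \<in> E'" "j < n" "v \<in> pverts G'" for U U' j v
    proof -
      have "\<psi>s ! j \<in> set \<psi>s" using that n_def by simp
      then have "U X \<subseteq> pverts G \<and> U' X \<subseteq> pverts G'" if "X \<in> free_s (\<psi>s ! j)" for X
        using wf that sub[OF \<open>U \<in> E\<close> \<open>U' \<in> E'\<close>] unfolding basic_wf_def by blast
      then have "sat ?J ?o (\<lambda>_. v) (\<lambda>X. U X \<union> U' X) (\<psi>s ! j) \<longleftrightarrow> (\<exists>i\<in>{..<N2 j}. L2 j i G r un U \<and> R2 j i G' r' (\<lambda>_. v) U')"
        using splitsD[OF sp2 dis, of j un "\<lambda>_. v" U U'] that(4) by simp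
      then show ?thesis using that(3) by (auto simp: in_t)
    qed
    define w where "w U = (\<Prod>j<n. \<Prod>v\<in>{v \<in> pverts ?J. sat ?J ?o (\<lambda>_. v) U (\<psi>s ! j)}. indet j)" for U
    have weight: "w (\<lambda>X. U X \<union> U' X) = F (t' G' r' U') G r U * F' (t G r U) G' r' U'"
      if "U \<in> E" "U' \<in> E'" for U U'
      unfolding w_def F_def F'_def prod.distrib[symmetric]
    proof (rule prod.cong[OF refl], goal_cases)
      case (1 j)
      then have j: "j < n" by simp
      have "{v \<in> pverts ?J. sat ?J ?o (\<lambda>_. v) (\<lambda>X. U X \<union> U' X) (\<psi>s ! j)} =
          {v \<in> pverts G. \<exists>i<N1 j. L1 j i G r (\<lambda>_. v) U \<and> (Suc j, i) \<in> t' G' r' U'} \<union>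
          {v \<in> pverts G'. \<exists>i<N2 j. (Suc j, i) \<in> t G r U \<and> R2 j i G' r' (\<lambda>_. v) U'}"
        using sat_left[OF that j] sat_right[OF that j] by auto
      then show ?case
        using d(5,6,7) by (simp only:) (rule prod.union_disjoint; auto)
    qed
    let ?g = "\<lambda>(U, U'). (t G r U, t' G' r' U')"
    let ?h = "\<lambda>(U, U'). if ok (t G r U) (t' G' r' U')
        then F (t' G' r' U') G r U * F' (t G r U) G' r' U' else 0"
    have "basic_poly s \<phi> \<psi>s ?J ?o =
        (\<Sum>U\<in>{..<s} \<rightarrow>\<^sub>E Pow (pverts G \<union> pverts G'). if sat ?J ?o un U \<phi> then w U else 0)"
      unfolding basic_poly_def w_def n_def un_def pverts_join
      by (rule sum.mono_neutral_cong_left) (use d(6,7) in \<open>auto intro!: finite_PiE\<close>)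
    also have "\<dots> = (\<Sum>UU\<in>E \<times> E'. case UU of (U, U') \<Rightarrow>
        if sat ?J ?o un (\<lambda>X. U X \<union> U' X) \<phi> then w (\<lambda>X. U X \<union> U' X) else 0)"
      using sum.reindex_bij_betw[OF bij_betw_PiE_Pow_Un[OF d(5), of "{..<s}"],
          of "\<lambda>U. if sat ?J ?o un U \<phi> then w U else 0"]
      unfolding E_def E'_def split_def by simp
    also have "\<dots> = (\<Sum>UU\<in>E \<times> E'. ?h UU)"
      by (rule sum.cong) (auto simp: sat_\<phi> weight)
    also have "\<dots> = (\<Sum>TT\<in>Pow Z \<times> Pow Z'. \<Sum>UU\<in>{UU \<in> E \<times> E'. ?g UU = TT}. ?h UU)"
      by (rule sum.group[symmetric])
        (use fin in \<open>auto simp: Z_def Z'_def t_def t'_def\<close>)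
    also have "\<dots> = (\<Sum>TT\<in>Pow Z \<times> Pow Z'. \<alpha> TT G r * \<beta> TT G' r')"
    proof (rule sum.cong[OF refl], clarify)
      fix T T'
      \<comment> \<open>Each type depends on its own part of the tuple only, so the fibre is a
        product set and the sum over it factors.\<close>
      have "{UU \<in> E \<times> E'. ?g UU = (T, T')} = {U \<in> E. t G r U = T} \<times> {U \<in> E'. t' G' r' U = T'}"
        by auto
      then have "(\<Sum>UU\<in>{UU \<in> E \<times> E'. ?g UU = (T, T')}. ?h UU) =
          (\<Sum>(U, U')\<in>{U \<in> E. t G r U = T} \<times> {U \<in> E'. t' G' r' U = T'}.
             if ok T T' then F T' G r U * F' T G' r' U' else 0)"
        by (auto intro!: sum.cong)
      also have "\<dots> = \<alpha> (T, T') G r * \<beta> (T, T') G' r'"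
        by (simp add: \<alpha>_def \<beta>_def E_def E'_def sum_product sum.cartesian_product)
      finally show "(\<Sum>UU\<in>{UU \<in> E \<times> E'. ?g UU = (T, T')}. ?h UU) =
          \<alpha> (T, T') G r * \<beta> (T, T') G' r'" .
    qed
    finally show "basic_poly s \<phi> \<psi>s ?J ?o = (\<Sum>TT\<in>Pow Z \<times> Pow Z'. \<alpha> TT G r * \<beta> TT G' r')" .
  qed
qed

lemma finite_join_rank_msol_expr: "msol_expr p \<Longrightarrow> finite_join_rank p"
  by (induction rule: msol_expr.induct)
    (simp_all add: finite_join_rank_basic finite_join_rank_add finite_join_rank_mult)

section \<open>Evaluation and rank\<close>

lemma subst_poly_0: "subst_poly \<sigma> 0 = 0"
  by (simp add: subst_poly_def)

lemma subst_poly_add: "subst_poly \<sigma> (p + q) = subst_poly \<sigma> p + subst_poly \<sigma> q"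
  unfolding subst_poly_def
  by (rule setsum_keys_plus_distrib) (simp_all add: algebra_simps)

lemma subst_poly_diff: "subst_poly \<sigma> (p - q) = subst_poly \<sigma> p - subst_poly \<sigma> q"
  using subst_poly_add[of \<sigma> "p - q" q] by simp

lemma subst_poly_sum: "subst_poly \<sigma> (sum f I) = (\<Sum>i\<in>I. subst_poly \<sigma> (f i))"
  by (induction I rule: infinite_finite_induct) (simp_all add: subst_poly_0 subst_poly_add)

lemma subst_poly_frag_of_add:
  "subst_poly \<sigma> (frag_of (m + m')) = subst_poly \<sigma> (frag_of m) * subst_poly \<sigma> (frag_of m')"
proof -
  \<comment> \<open>Writing all three monomials over a common index set, with exponent 0 outside
    their supports, allows exponents to be added factor by factor.\<close>
  let ?K = "Poly_Mapping.keys m \<union> Poly_Mapping.keys m'"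
  have monomial: "subst_poly \<sigma> (frag_of k) = (\<Prod>j\<in>?K. \<sigma> j ^ Poly_Mapping.lookup k j)"
    if "Poly_Mapping.keys k \<subseteq> ?K" for k
  proof -
    have "subst_poly \<sigma> (frag_of k) = (\<Prod>j\<in>Poly_Mapping.keys k. \<sigma> j ^ Poly_Mapping.lookup k j)"
      by (simp add: subst_poly_def keys_frag_of)
    also have "\<dots> = (\<Prod>j\<in>?K. \<sigma> j ^ Poly_Mapping.lookup k j)"
      using that by (intro prod.mono_neutral_left) (auto simp: in_keys_iff)
    finally show ?thesis .
  qed
  show ?thesis
    using Poly_Mapping.keys_add[of m m']
    by (subst (1 2 3) monomial) (auto simp: lookup_add power_add prod.distrib)
qed

text \<open>Integer polynomials form the free abelian group on the monomials
  \<open>frag_of m\<close>. As both sides are additive in each argument, induction over differences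
  reduces the claim first to \<open>p\<close> a monomial and then to two monomials.\<close>

lemma subst_poly_mult: "subst_poly \<sigma> (p * q) = subst_poly \<sigma> p * subst_poly \<sigma> q"
proof -
  have 1: "subst_poly \<sigma> (frag_of m * q) = subst_poly \<sigma> (frag_of m) * subst_poly \<sigma> q" for m
    using subset_UNIV[of "Poly_Mapping.keys q"]
  proof (induction q rule: frag_induction)
    case (one m')
    have "frag_of m * frag_of m' = frag_of (m + m')" by (simp add: mult_single)
    then show ?case by (simp add: subst_poly_frag_of_add)
  qed (simp_all add: subst_poly_0 right_diff_distrib subst_poly_diff)
  show ?thesis
    using subset_UNIV[of "Poly_Mapping.keys p"]
    by (induction p rule: frag_induction)
      (simp_all add: 1 subst_poly_0 left_diff_distrib subst_poly_diff)
qed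

section \<open>Linear dependence and antitriangular matrices\<close>

lemma linear_dependence:
  fixes v :: "'i \<Rightarrow> nat \<Rightarrow> 'a::idom"
  assumes "finite I" "n < card I"
  shows "\<exists>c. (\<exists>i\<in>I. c i \<noteq> 0) \<and> (\<forall>j<n. (\<Sum>i\<in>I. c i * v i j) = 0)"
  using assms
proof (induction n arbitrary: I v)
  case 0
  then have "I \<noteq> {}" by auto
  then show ?case by (intro exI[of _ "\<lambda>_. 1"]) auto
next
  case (Suc n)
  show ?case
  proof (cases "\<forall>i\<in>I. v i n = 0")
    case True
    have "n < card I" using Suc.prems by simp
    then obtain c where "\<exists>i\<in>I. c i \<noteq> 0" "\<forall>j<n. (\<Sum>i\<in>I. c i * v i j) = 0"
      using Suc.IH[of I v] Suc.prems by blast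
    then show ?thesis using True by (intro exI[of _ c]) (auto simp: less_Suc_eq)
  next
    case False
    then obtain k where k: "k \<in> I" "v k n \<noteq> 0" by blast
    have card: "n < card (I - {k})" using Suc.prems k by simp
    obtain c where c: "\<exists>i\<in>I - {k}. c i \<noteq> 0"
      and c0: "\<forall>j<n. (\<Sum>i\<in>I - {k}. c i * (v k n * v i j - v i n * v k j)) = 0"
      \<comment> \<open>Elimination without division: with the pivot \<open>v k n\<close>, cross
        multiplication clears coordinate \<open>n\<close> of every other vector.\<close>
      using Suc.IH[of "I - {k}" "\<lambda>i j. v k n * v i j - v i n * v k j"] card Suc.prems by auto
    \<comment> \<open>These coefficients undo the cross multiplication: the dependence of the
      eliminated vectors becomes one of the original vectors. It stays nontrivial because the pivot
      is nonzero in an integral domain.\<close>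
    define d where "d i = (if i = k then - (\<Sum>i\<in>I - {k}. c i * v i n) else v k n * c i)" for i
    have "(\<Sum>i\<in>I. d i * v i j) = (\<Sum>i\<in>I - {k}. c i * (v k n * v i j - v i n * v k j))" for j
    proof -
      have "(\<Sum>i\<in>I. d i * v i j) = d k * v k j + (\<Sum>i\<in>I - {k}. d i * v i j)"
        using Suc.prems k by (simp add: sum.remove)
      also have "(\<Sum>i\<in>I - {k}. d i * v i j) = (\<Sum>i\<in>I - {k}. v k n * c i * v i j)"
        by (rule sum.cong) (auto simp: d_def)
      finally show ?thesis
        by (simp add: d_def sum_distrib_left right_diff_distrib sum_subtractf mult_ac)
    qed
    then have "\<forall>j<Suc n. (\<Sum>i\<in>I. d i * v i j) = 0"
      using c0 by (auto simp: less_Suc_eq)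
    moreover have "\<exists>i\<in>I. d i \<noteq> 0" using c k by (auto simp: d_def)
    ultimately show ?thesis by blast
  qed
qed

text \<open>If \<open>R\<close> were at most \<open>M\<close>, the \<open>M + 1\<close> rows
  \<open>a i\<close> would be dependent. Let \<open>k\<close> be the least index with a nonzero
  coefficient and pair the relation with column \<open>M - k\<close>: earlier rows have coefficient
  0, later rows lie beyond the antidiagonal and give 0, and the antidiagonal term alone
  remains.\<close>

lemma antitriangular_rank:
  fixes a b :: "nat \<Rightarrow> nat \<Rightarrow> 'a::idom"
  assumes anti: "\<And>i. i \<le> M \<Longrightarrow> (\<Sum>c<R. a i c * b (M - i) c) \<noteq> 0"
    and zero: "\<And>i j. i \<le> M \<Longrightarrow> j \<le> M \<Longrightarrow> M < i + j \<Longrightarrow> (\<Sum>c<R. a i c * b j c) = 0"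
  shows "M < R"
proof (rule ccontr)
  assume "\<not> M < R"
  then obtain l where l: "\<exists>i\<in>{..M}. l i \<noteq> 0" "\<forall>c<R. (\<Sum>i\<le>M. l i * a i c) = 0"
    using linear_dependence[of "{..M}" R a] by auto
  define k where "k = (LEAST i. l i \<noteq> 0)"
  have k: "k \<le> M" "l k \<noteq> 0" and least: "\<And>i. i < k \<Longrightarrow> l i = 0"
    using l(1) not_less_Least LeastI[of "\<lambda>i. l i \<noteq> 0"] Least_le[of "\<lambda>i. l i \<noteq> 0"]
    unfolding k_def by (fastforce intro: order_trans)+
  have "0 = (\<Sum>c<R. (\<Sum>i\<le>M. l i * a i c) * b (M - k) c)" using l(2) by simp
  also have "\<dots> = (\<Sum>i\<le>M. l i * (\<Sum>c<R. a i c * b (M - k) c))"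
    by (simp add: sum_distrib_left sum_distrib_right mult.assoc) (rule sum.swap)
  also have "\<dots> = (\<Sum>i\<in>{k}. l i * (\<Sum>c<R. a i c * b (M - k) c))"
  proof (rule sum.mono_neutral_right)
    show "\<forall>i\<in>{..M} - {k}. l i * (\<Sum>c<R. a i c * b (M - k) c) = 0"
    proof
      fix i assume i: "i \<in> {..M} - {k}"
      show "l i * (\<Sum>c<R. a i c * b (M - k) c) = 0"
      proof (cases "i < k")
        case True
        then show ?thesis by (simp add: least)
      next
        case False
        then have "i \<le> M" "M < i + (M - k)" using i k by auto
        then show ?thesis using zero[of i "M - k"] by simp
      qed
    qed
  qed (use k in auto)
  finally show False using k anti by simp
qed

section \<open>Zeros of the Harary polynomial at natural numbers\<close>

lemma poly_falling_poly:
  "poly (falling_poly i) (of_nat k :: 'a::comm_ring_1) = of_nat (\<Prod>j<i. k - j)"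
proof (cases "i \<le> k")
  case True
  then show ?thesis
    by (auto simp: falling_poly_def poly_prod of_nat_diff intro!: prod.cong)
next
  case False
  \<comment> \<open>For \<open>i > k\<close> the factor with \<open>j = k\<close> vanishes on both
    sides, so truncated subtraction in the later factors does no harm.\<close>
  then have "(\<Prod>j<i. of_nat k + - of_nat j :: 'a) = 0" "(\<Prod>j<i. k - j) = 0"
    by (auto intro!: prod_zero bexI[of _ k])
  then show ?thesis by (simp add: falling_poly_def poly_prod del: of_nat_prod prod_zero_iff)
qed

text \<open>The value is the image of a sum of natural numbers. In characteristic zero it vanishes
  only if every term does, and term \<open>i\<close> is nonzero exactly when
  \<open>i \<le> k\<close> and there is a partition into \<open>i\<close> blocks from
  \<open>P\<close>.\<close>

lemma poly_harary_poly_eq_0_iff: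
  assumes fin: "finite (pverts G)"
  shows "poly (harary_poly P G) (of_nat k :: 'a::{idom, ring_char_0}) = 0 \<longleftrightarrow> \<not> colourable P k G"
proof -
  let ?S = "\<lambda>i. {\<pi>. partition_on (pverts G) \<pi> \<and> card \<pi> = i \<and> (\<forall>B\<in>\<pi>. induced G B \<in> P)}"
  have finS: "finite (?S i)" for i
    by (rule finite_subset[OF _ finitely_many_partition_on[OF fin]]) auto
  \<comment> \<open>Blocks are nonempty, so no partition has more blocks than the summation range of
    \<open>harary_poly\<close> allows.\<close>
  have le: "card \<pi> \<le> card (pverts G)" if "partition_on (pverts G) \<pi>" for \<pi>
  proof -
    have "B \<noteq> {} \<and> finite B" if "B \<in> \<pi>" for B
      using that \<open>partition_on (pverts G) \<pi>\<close> fin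
      by (metis partition_onD1 partition_onD3 Union_upper finite_subset)
    then have "card \<pi> \<le> (\<Sum>B\<in>\<pi>. card B)"
      using sum_mono[of \<pi> "\<lambda>_. 1" card] by (simp add: Suc_le_eq card_gt_0_iff)
    then show ?thesis
      using product_partition[OF that] fin that by (metis partition_onD1 Union_upper finite_subset)
  qed
  have "poly (harary_poly P G) (of_nat k :: 'a) =
      of_nat (\<Sum>i\<le>card (pverts G). num_partitions P G i * (\<Prod>j<i. k - j))"
    by (simp add: harary_poly_def poly_sum poly_falling_poly)
  then have "poly (harary_poly P G) (of_nat k :: 'a) = 0 \<longleftrightarrow>
      (\<forall>i\<le>card (pverts G). num_partitions P G i = 0 \<or> k < i)"
    by (auto simp del: of_nat_sum) 
  also have "\<dots> \<longleftrightarrow> \<not> colourable P k G"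
    using finS le by (auto simp: num_partitions_def colourable_def not_le)
  finally show ?thesis .
qed

section \<open>Non-definability\<close>

lemma join_blowup:
  assumes "S \<inter> S' = {}"
  shows "join (blowup H S) (blowup H S') = blowup H (S \<union> S')"
proof -
  have "parcs (join (blowup H S) (blowup H S')) = parcs (blowup H (S \<union> S'))"
  proof (intro equalityI subsetI)
    fix e assume "e \<in> parcs (join (blowup H S) (blowup H S'))"
    then obtain m m' u v where "e = (prod_encode (m, u), prod_encode (m', v))"
      "m \<in> S \<union> S'" "m' \<in> S \<union> S'" "u \<in> pverts H" "v \<in> pverts H" "m = m' \<longrightarrow> (u, v) \<in> parcs H"
      using assms unfolding join_def blowup_def by fastforce
    then show "e \<in> parcs (blowup H (S \<union> S'))" unfolding blowup_def by auto
  next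
    fix e assume "e \<in> parcs (blowup H (S \<union> S'))"
    then obtain m m' u v where "e = (prod_encode (m, u), prod_encode (m', v))"
      "m \<in> S \<union> S'" "m' \<in> S \<union> S'" "u \<in> pverts H" "v \<in> pverts H" "m = m' \<longrightarrow> (u, v) \<in> parcs H"
      unfolding blowup_def by auto
    then show "e \<in> parcs (join (blowup H S) (blowup H S'))"
      unfolding join_def blowup_def by auto
  qed
  then show ?thesis by (auto simp: join_def blowup_def)
qed

text \<open>Definability equates the polynomial with its defining expression for linear orders only;
  this makes the equation available on joins.\<close>

lemma linear_order_on_order_sum:
  assumes "disjoint_ordered G r G' r'"
  shows "linear_order_on (pverts (join G G')) (order_sum G r G' r')"
proof -
  have lin: "linear_order_on (pverts G) r" "linear_order_on (pverts G') r'"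
    using assms by (simp_all add: disjoint_ordered_def ordered_graph_def)
  note d = disjoint_orderedD(3-5)[OF assms]
  have "refl_on (pverts (join G G')) (order_sum G r G' r')"
    using lin by (auto simp: order_on_defs refl_on_def order_sum_def)
  moreover have "order_sum G r G' r' \<subseteq> pverts (join G G') \<times> pverts (join G G')"
    using d by (auto simp: order_sum_def)
  moreover have "total_on (pverts (join G G')) (order_sum G r G' r')"
    using lin by (auto simp: order_on_defs total_on_def order_sum_def)
  moreover have "antisym (order_sum G r G' r')"
  proof (rule antisymI)
    fix x y assume xy: "(x, y) \<in> order_sum G r G' r'" "(y, x) \<in> order_sum G r G' r'"
    then have "(x, y) \<in> r \<and> (y, x) \<in> r \<or> (x, y) \<in> r' \<and> (y, x) \<in> r'"
      using d unfolding order_sum_def by blast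
    then show "x = y" using lin by (auto simp: order_on_defs dest: antisymD)
  qed
  moreover have "trans (order_sum G r G' r')"
  proof (rule transI)
    fix x y z assume xyz: "(x, y) \<in> order_sum G r G' r'" "(y, z) \<in> order_sum G r G' r'"
    then consider "(x, y) \<in> r" "(y, z) \<in> r" | "(x, y) \<in> r'" "(y, z) \<in> r'" |
      "x \<in> pverts G" "z \<in> pverts G'"
      using d unfolding order_sum_def by blast
    then show "(x, z) \<in> order_sum G r G' r'"
      using lin by cases (auto simp: order_on_defs order_sum_def dest: transD)
  qed
  ultimately show ?thesis by (simp add: order_on_defs)
qed

lemma linear_order_on_le: "linear_order_on (V :: nat set) {(x, y). x \<in> V \<and> y \<in> V \<and> x \<le> y}"
  by (auto simp: order_on_defs refl_on_def trans_def antisym_def total_on_def)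

lemma not_msol_definable_clique_free:
  assumes P: "graph_property P" and "H \<in> P" "pverts H \<noteq> {}" "ultimately_clique_free P"
  shows "\<not> msol_definable (harary_poly P :: ngraph \<Rightarrow> 'a::{idom, ring_char_0} poly)"
proof
  assume "msol_definable (harary_poly P :: ngraph \<Rightarrow> 'a poly)"
  then obtain f \<sigma> p where p: "msol_expr p"
    and f: "\<And>G r. pair_graph G \<Longrightarrow> linear_order_on (pverts G) r \<Longrightarrow> f G = p G r"
    and \<sigma>: "\<And>G. pair_graph G \<Longrightarrow> (harary_poly P G :: 'a poly) = subst_poly \<sigma> (f G)"
    unfolding msol_definable_def msol_definable_multi_def by blast
  obtain t where free: "\<And>G H. G \<in> P \<Longrightarrow> subgraph (with_proj (H :: ngraph)) (with_proj G) \<Longrightarrow>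
      \<not> complete_digraph t (with_proj H)"
    using assms(4) unfolding ultimately_clique_free_def by blast
  have H: "pair_graph H" using assms by (simp add: graph_property_def)
  show False
  proof (rule finite_join_rankE[OF finite_join_rank_msol_expr[OF p]], goal_cases)
    case (1 R \<alpha> \<beta>)
    \<comment> \<open>The bound \<open>R\<close> comes from the expression before any evaluation, so
      the evaluation point may be chosen equal to it.\<close>
    define ev :: "mpoly \<Rightarrow> 'a" where "ev q = poly (subst_poly \<sigma> q) (of_nat R)" for q
    \<comment> \<open>Even indices for rows and odd ones for columns make the two factors of every
      join disjoint.\<close>
    define S where "S i = (\<lambda>m. 2 * m) ` {..<i}" for i :: nat
    define S' where "S' i = (\<lambda>m. Suc (2 * m)) ` {..<i}" for i :: nat
    define le where "le V = {(x, y). x \<in> V \<and> y \<in> V \<and> x \<le> y}" for V :: "nat set"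
    define G where "G i = blowup H (S i)" for i
    define G' where "G' i = blowup H (S' i)" for i
    define a where "a i c = ev (\<alpha> c (G i) (le (pverts (G i))))" for i c
    define b where "b i c = ev (\<beta> c (G' i) (le (pverts (G' i))))" for i c
    define col where "col n \<longleftrightarrow> colourable P R (blowup H {..<n})" for n
    have entry: "(\<Sum>c<R. a i c * b j c) = 0 \<longleftrightarrow> \<not> col (i + j)" for i j
    proof -
      have S: "finite (S i)" "finite (S' j)" "S i \<inter> S' j = {}"
        unfolding S_def S'_def by (auto, presburger)
      then have card: "card (S i \<union> S' j) = i + j"
        by (subst card_Un_disjoint) (simp_all add: S_def S'_def card_image inj_on_def)
      have dis: "disjoint_ordered (G i) (le (pverts (G i))) (G' j) (le (pverts (G' j)))"
        using S H unfolding disjoint_ordered_def ordered_graph_def le_def G_def G'_def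
        by (auto simp: pair_graph_blowup linear_order_on_le) (auto simp: blowup_def)
      let ?o = "order_sum (G i) (le (pverts (G i))) (G' j) (le (pverts (G' j)))"
      let ?J = "blowup H (S i \<union> S' j)"
      have J: "join (G i) (G' j) = ?J" unfolding G_def G'_def by (rule join_blowup[OF S(3)])
      have pg: "pair_graph ?J" using S H by (simp add: pair_graph_blowup)
      have "ev (p ?J ?o) = (\<Sum>c<R. a i c * b j c)"
        using 1[OF dis] unfolding J
        by (simp add: ev_def a_def b_def subst_poly_sum subst_poly_mult poly_sum)
      moreover have "f ?J = p ?J ?o"
        using linear_order_on_order_sum[OF dis] unfolding J by (rule f[OF pg])
      ultimately have "(\<Sum>c<R. a i c * b j c) = poly (harary_poly P ?J) (of_nat R)"
        by (simp add: ev_def \<sigma>[OF pg])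
      then show ?thesis
        using poly_harary_poly_eq_0_iff[of ?J P R, where 'a = 'a] pg
          colourable_blowup_card[OF P H, of "S i \<union> S' j" R] S(1,2)
        by (simp add: col_def card pair_graph_iff)
    qed
    \<comment> \<open>Clique-freeness enters here: it makes the set of colourable sizes finite, so
      that a largest one, \<open>M\<close>, exists.\<close>
    have bound: "n \<le> R * t" if "col n" for n
      using colourable_blowup_bound[where S = "{..<n}" and k = R, OF P H assms(3) _ free] that
      by (simp add: col_def)
    have "col R" unfolding col_def
      by (rule colourable_blowup_small[OF P assms(2,3)]) simp_all
    define M where "M = Max (Collect col)"
    have fin: "finite (Collect col)"
      by (rule finite_subset[of _ "{..R * t}"]) (use bound in auto)
    have "R \<le> M" using fin \<open>col R\<close> by (simp add: M_def)
    have "col M" using Max_in[OF fin] \<open>col R\<close> unfolding M_def by blast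
    have max: "\<not> col n" if "M < n" for n
      using fin that unfolding M_def by (metis Max_ge mem_Collect_eq not_less)
    \<comment> \<open>Antidiagonal entries have \<open>i + j = M\<close> and are nonzero as
      \<open>col M\<close> holds; entries with a larger sum vanish by maximality of
      \<open>M\<close>.\<close>
    have "M < R"
      by (rule antitriangular_rank[where a = a and b = b]) (use entry \<open>col M\<close> max in auto)
    with \<open>R \<le> M\<close> show False by simp
  qed
qed

theorem theorem12:
  fixes P :: "nat pair_pre_digraph set"
  assumes "graph_property P"
    and "\<not> trivial_property P"
    and "monotone_property P \<or> ultimately_clique_free P \<or> weakly_sparse P"
  shows "\<not> msol_definable
    (harary_poly P :: nat pair_pre_digraph \<Rightarrow> 'a::{idom, ring_char_0} poly)"
proof -
  obtain H where H: "H \<in> P" "pverts H \<noteq> {}"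
    using assms(1,2) by (rule nontrivial_nonempty)
  \<comment> \<open>The graph missing from \<open>P\<close> that the monotone case requires.\<close>
  obtain F where F: "pair_graph F" "F \<notin> P"
    using assms(2) unfolding trivial_property_def by blast
  have "ultimately_clique_free P"
    using assms(3) ultimately_clique_free_weakly_sparse[OF assms(1)]
      ultimately_clique_free_monotone[OF assms(1) _ F] by blast
  then show ?thesis by (rule not_msol_definable_clique_free[OF assms(1) H])
qed

end
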